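(* Let $\mathcal H$ be a finite hypergraph with vertices $v_1,\dots,v_n$ and hyperedges $\lambda_1,\dots,\lambda_h$, let $L=L_K(\mathcal H)$ (a unital algebra with $1=\sum_kv_k$), and let $A,B$ be the $h\times n$ integer matrices with $A_{k\ell}=|\{i\in I_{\lambda_k}: s(\lambda_k)_i=v_\ell\}|$ and $B_{k\ell}=|\{j\in J_{\lambda_k}: r(\lambda_k)_j=v_\ell\}|$. Assume the confluence condition holds in the free commutative monoid $T$ on $\{v_1,\dots,v_n\}$. Then $L$ has Invariant Basis Number if and only if $\mathrm{rank}(B^t-A^t)<\mathrm{rank}([B^t-A^t\ \ c])$, where $c$ is the $n\times1$ column with all entries $1$ and ranks are over $\mathbb Q$.
   Context: $K$ is a field. A hypergraph $\mathcal H=(\mathcal H^0,\mathcal H^1,s,r)$: vertex set $\mathcal H^0$, hyperedge set $\mathcal H^1$, and for each hyperedge $\lambda$ nonempty index sets $I_\lambda,J_\lambda$ with families $s(\lambda)=(s(\lambda)_i)_{i\in I_\lambda}$, $r(\lambda)=(r(\lambda)_j)_{j\in J_\lambda}$ of vertices; finite means $\mathcal H^0$, $\mathcal H^1$ and all $I_\lambda,J_\lambda$ are finite. $L_K(\mathcal H)$ is the $K$-algebra generated by $\{v,\lambda_{ij},\lambda_{ij}^*\}$ subject to $uv=\delta_{u,v}u$; $s(\lambda)_i\lambda_{ij}=\lambda_{ij}=\lambda_{ij}r(\lambda)_j$, $r(\lambda)_j\lambda_{ij}^*=\lambda_{ij}^*=\lambda_{ij}^*s(\lambda)_i$; $\sum_{j\in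 J_\lambda}\lambda_{ij}\lambda_{kj}^*=\delta_{ik}s(\lambda)_i$; $\sum_{i\in I_\lambda}\lambda_{ij}^*\lambda_{ik}=\delta_{jk}r(\lambda)_j$. $\mathcal V(L)$ is the commutative monoid of Murray–von Neumann classes $[e]$ of idempotent matrices over $L$ with finitely many nonzero entries ($e\sim f$ iff $e=xy$, $f=yx$), with $[e]+[f]=[\mathrm{diag}(e,f)]$; for $x=\sum_\ell x_\ell v_\ell\in T$ write $[x]=\sum_\ell x_\ell[v_\ell]\in\mathcal V(L)$. A unital ring $L$ has Invariant Basis Number if $L^m\cong L^p$ as left modules implies $m=p$. For $k\in\{1,\dots,h\}$ let $a_k,b_k\in T$ be the $k$-th rows of $A$, $B$ (i.e. $a_k=\sum_{i\in I_{\lambda_k}}s(\lambda_k)_i$, $b_k=\sum_{j\in J_{\lambda_k}}r(\lambda_k)_j$). The partial operation $M_k$ on $T$ is defined on $x\in T$ with $x\ge a_k$ coordinatewise by $M_k(x)=x-a_k+b_k$. For a finite sequence $\sigma=(k_1,\dots,k_t)$ in $\{1,\dots,h\}$, $\Delta_\sigma(x)=M_{k_t}(\cdots M_{k_1}(x))$ when defined. The confluence condition holds in $T$ if for all $x,y\in T$: $[x]=[y]$ in $\mathcal V(L)$ if and only if there exist finite sequences $\sigma,\sigma'$ with $\Delta_\sigma(x)$ and $\Delta_{\sigma'}(y)$ defined and equal in $T$. *)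

theory Defs
  imports "HOL-Library.Function_Algebras" "HOL-Algebra.QuotRing" "Jordan_Normal_Form.DL_Rank"
begin

text \<open>Vertices are v_0,...,v_(n-1) (indices < n), hyperedges lambda_0,...,lambda_(h-1)
  (indices < h); for hyperedge k the index sets are I_k = {0..<ni k} and
  J_k = {0..<nj k}; src k i = s(lambda_k)_i and rng k j = r(lambda_k)_j.\<close>

record hgraph =
  nv :: nat
  ne :: nat
  ni :: "nat \<Rightarrow> nat"
  nj :: "nat \<Rightarrow> nat"
  src :: "nat \<Rightarrow> nat \<Rightarrow> nat"
  rng :: "nat \<Rightarrow> nat \<Rightarrow> nat"

definition finite_hypergraph :: "hgraph \<Rightarrow> bool" where
  "finite_hypergraph H \<longleftrightarrow>
     (\<forall>k < ne H. 1 \<le> ni H k \<and> 1 \<le> nj H k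
        \<and> (\<forall>i < ni H k. src H k i < nv H) \<and> (\<forall>j < nj H k. rng H k j < nv H))"

text \<open>Generators: V v = vertex v; E k i j = lambda_k_ij; Es k i j = lambda_k_ij^*.\<close>

datatype gen = V nat | E nat nat nat | Es nat nat nat

fun valid_gen :: "hgraph \<Rightarrow> gen \<Rightarrow> bool" where
  "valid_gen H (V v) \<longleftrightarrow> v < nv H"
| "valid_gen H (E k i j) \<longleftrightarrow> k < ne H \<and> i < ni H k \<and> j < nj H k"
| "valid_gen H (Es k i j) \<longleftrightarrow> k < ne H \<and> i < ni H k \<and> j < nj H k"

text \<open>The free (non-unital) K-algebra on the generators: finitely supported
  K-valued functions on nonempty words in the valid generators, with the
  convolution product induced by concatenation of words.\<close>

definition monom :: "gen list \<Rightarrow> 'k::field \<Rightarrow> gen list \<Rightarrow> 'k" where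
  "monom w c = (\<lambda>u. if u = w then c else 0)"

definition fa_mult :: "(gen list \<Rightarrow> 'k::field) \<Rightarrow> (gen list \<Rightarrow> 'k) \<Rightarrow> gen list \<Rightarrow> 'k" where
  "fa_mult f g = (\<lambda>w. \<Sum>i\<in>{1..<length w}. f (take i w) * g (drop i w))"

definition fa_carrier :: "hgraph \<Rightarrow> (gen list \<Rightarrow> 'k::field) set" where
  "fa_carrier H = {f. finite {w. f w \<noteq> 0}
      \<and> (\<forall>w. f w \<noteq> 0 \<longrightarrow> w \<noteq> [] \<and> (\<forall>g\<in>set w. valid_gen H g))}"

definition vsum :: "hgraph \<Rightarrow> gen list \<Rightarrow> 'k::field" where
  "vsum H = (\<Sum>v<nv H. monom [V v] 1)"

definition FA :: "hgraph \<Rightarrow> (gen list \<Rightarrow> 'k::field) ring" where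
  "FA H = \<lparr>carrier = fa_carrier H, mult = fa_mult, one = vsum H,
           zero = 0, add = (+)\<rparr>"

definition hrels :: "hgraph \<Rightarrow> (gen list \<Rightarrow> 'k::field) set" where
  "hrels H =
     {monom [V u, V v] 1 - (if u = v then monom [V u] 1 else 0) | u v. u < nv H \<and> v < nv H}
   \<union> {monom [V (src H k i), E k i j] 1 - monom [E k i j] 1 | k i j. valid_gen H (E k i j)}
   \<union> {monom [E k i j, V (rng H k j)] 1 - monom [E k i j] 1 | k i j. valid_gen H (E k i j)}
   \<union> {monom [V (rng H k j), Es k i j] 1 - monom [Es k i j] 1 | k i j. valid_gen H (Es k i j)}
   \<union> {monom [Es k i j, V (src H k i)] 1 - monom [Es k i j] 1 | k i j. valid_gen H (Es k i j)}
   \<union> {(\<Sum>j<nj H k. monom [E k i j, Es k i' j] 1) - (if i = i' then monom [V (src H k i)] 1 else 0)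
        | k i i'. k < ne H \<and> i < ni H k \<and> i' < ni H k}
   \<union> {(\<Sum>i<ni H k. monom [Es k i j, E k i j'] 1) - (if j = j' then monom [V (rng H k j)] 1 else 0)
        | k j j'. k < ne H \<and> j < nj H k \<and> j' < nj H k}"

inductive_set hideal :: "hgraph \<Rightarrow> (gen list \<Rightarrow> 'k::field) set" for H where
  rel: "r \<in> hrels H \<Longrightarrow> r \<in> hideal H"
| zero: "0 \<in> hideal H"
| add: "x \<in> hideal H \<Longrightarrow> y \<in> hideal H \<Longrightarrow> x + y \<in> hideal H"
| smult: "x \<in> hideal H \<Longrightarrow> (\<lambda>w. c * x w) \<in> hideal H"
| lmult: "a \<in> fa_carrier H \<Longrightarrow> x \<in> hideal H \<Longrightarrow> fa_mult a x \<in> hideal H"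
| rmult: "a \<in> fa_carrier H \<Longrightarrow> x \<in> hideal H \<Longrightarrow> fa_mult x a \<in> hideal H"

definition LK :: "hgraph \<Rightarrow> (gen list \<Rightarrow> 'k::field) set ring" where
  "LK H = FactRing (FA H) (hideal H)"

definition vtx :: "hgraph \<Rightarrow> nat \<Rightarrow> (gen list \<Rightarrow> 'k::field) set" where
  "vtx H v = a_r_coset (FA H) (hideal H) (monom [V v] 1)"

definition Lpow :: "('a, 'b) ring_scheme \<Rightarrow> nat \<Rightarrow> (nat \<Rightarrow> 'a) set" where
  "Lpow L m = {f. (\<forall>i<m. f i \<in> carrier L) \<and> (\<forall>i\<ge>m. f i = \<zero>\<^bsub>L\<^esub>)}"

definition free_mod_iso :: "('a, 'b) ring_scheme \<Rightarrow> nat \<Rightarrow> nat \<Rightarrow> bool" where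
  "free_mod_iso L m p \<longleftrightarrow> (\<exists>\<phi>. bij_betw \<phi> (Lpow L m) (Lpow L p)
     \<and> (\<forall>x\<in>Lpow L m. \<forall>y\<in>Lpow L m. \<phi> (\<lambda>i. x i \<oplus>\<^bsub>L\<^esub> y i) = (\<lambda>i. \<phi> x i \<oplus>\<^bsub>L\<^esub> \<phi> y i))
     \<and> (\<forall>a\<in>carrier L. \<forall>x\<in>Lpow L m. \<phi> (\<lambda>i. a \<otimes>\<^bsub>L\<^esub> x i) = (\<lambda>i. a \<otimes>\<^bsub>L\<^esub> \<phi> x i)))"

definition IBN :: "('a, 'b) ring_scheme \<Rightarrow> bool" where
  "IBN L \<longleftrightarrow> (\<forall>m p. free_mod_iso L m p \<longrightarrow> m = p)"

definition fmat :: "('a, 'b) ring_scheme \<Rightarrow> (nat \<Rightarrow> nat \<Rightarrow> 'a) \<Rightarrow> bool" where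
  "fmat L x \<longleftrightarrow> (\<forall>i j. x i j \<in> carrier L) \<and> finite {(i, j). x i j \<noteq> \<zero>\<^bsub>L\<^esub>}"

definition matmul :: "('a, 'b) ring_scheme \<Rightarrow> (nat \<Rightarrow> nat \<Rightarrow> 'a) \<Rightarrow> (nat \<Rightarrow> nat \<Rightarrow> 'a) \<Rightarrow> nat \<Rightarrow> nat \<Rightarrow> 'a" where
  "matmul L x y = (\<lambda>i k. finsum L (\<lambda>j. x i j \<otimes>\<^bsub>L\<^esub> y j k) {j. \<exists>i'. x i' j \<noteq> \<zero>\<^bsub>L\<^esub>})"

definition idem_mat :: "('a, 'b) ring_scheme \<Rightarrow> (nat \<Rightarrow> nat \<Rightarrow> 'a) \<Rightarrow> bool" where
  "idem_mat L e \<longleftrightarrow> fmat L e \<and> matmul L e e = e"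

definition mvn :: "('a, 'b) ring_scheme \<Rightarrow> (nat \<Rightarrow> nat \<Rightarrow> 'a) \<Rightarrow> (nat \<Rightarrow> nat \<Rightarrow> 'a) \<Rightarrow> bool" where
  "mvn L e f \<longleftrightarrow> (\<exists>x y. fmat L x \<and> fmat L y \<and> e = matmul L x y \<and> f = matmul L y x)"

definition Vclass :: "('a, 'b) ring_scheme \<Rightarrow> (nat \<Rightarrow> nat \<Rightarrow> 'a) \<Rightarrow> (nat \<Rightarrow> nat \<Rightarrow> 'a) set" where
  "Vclass L e = {f. idem_mat L f \<and> mvn L e f}"

text \<open>Elements of T = free commutative monoid on v_0..v_(n-1): functions nat => nat
  vanishing outside {..<n}.  For x in T, [x] = sum x_l [v_l] is the class of the
  block diagonal matrix diag(v_0 (x_0 times), ..., v_(n-1) (x_(n-1) times)).\<close>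

definition inT :: "nat \<Rightarrow> (nat \<Rightarrow> nat) \<Rightarrow> bool" where
  "inT n x \<longleftrightarrow> (\<forall>l\<ge>n. x l = 0)"

definition diagT :: "('a, 'b) ring_scheme \<Rightarrow> (nat \<Rightarrow> 'a) \<Rightarrow> nat \<Rightarrow> (nat \<Rightarrow> nat) \<Rightarrow> nat \<Rightarrow> nat \<Rightarrow> 'a" where
  "diagT L vs n x = (let ls = concat (map (\<lambda>l. replicate (x l) l) [0..<n])
     in (\<lambda>i j. if i = j \<and> i < length ls then vs (ls ! i) else \<zero>\<^bsub>L\<^esub>))"

definition Tclass :: "hgraph \<Rightarrow> (nat \<Rightarrow> nat) \<Rightarrow> (nat \<Rightarrow> nat \<Rightarrow> (gen list \<Rightarrow> 'k::field) set) set" where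
  "Tclass H x = Vclass (LK H) (diagT (LK H) (vtx H) (nv H) x)"

definition Amat :: "hgraph \<Rightarrow> nat \<Rightarrow> nat \<Rightarrow> nat" where
  "Amat H k l = card {i. i < ni H k \<and> src H k i = l}"

definition Bmat :: "hgraph \<Rightarrow> nat \<Rightarrow> nat \<Rightarrow> nat" where
  "Bmat H k l = card {j. j < nj H k \<and> rng H k j = l}"

definition Mop :: "hgraph \<Rightarrow> nat \<Rightarrow> (nat \<Rightarrow> nat) \<Rightarrow> (nat \<Rightarrow> nat) option" where
  "Mop H k x = (if (\<forall>l. Amat H k l \<le> x l)
                then Some (\<lambda>l. x l - Amat H k l + Bmat H k l) else None)"

definition Delta :: "hgraph \<Rightarrow> nat list \<Rightarrow> (nat \<Rightarrow> nat) \<Rightarrow> (nat \<Rightarrow> nat) option" where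
  "Delta H \<sigma> x = fold (\<lambda>k ox. Option.bind ox (Mop H k)) \<sigma> (Some x)"

definition confluence :: "'k::field itself \<Rightarrow> hgraph \<Rightarrow> bool" where
  "confluence TYPE('k) H \<longleftrightarrow> (\<forall>x y. inT (nv H) x \<and> inT (nv H) y \<longrightarrow>
     ((Tclass H x :: (nat \<Rightarrow> nat \<Rightarrow> (gen list \<Rightarrow> 'k) set) set) = Tclass H y \<longleftrightarrow>
      (\<exists>\<sigma> \<sigma>'. set \<sigma> \<subseteq> {..<ne H} \<and> set \<sigma>' \<subseteq> {..<ne H}
           \<and> Delta H \<sigma> x \<noteq> None \<and> Delta H \<sigma> x = Delta H \<sigma>' y)))"

definition BAt :: "hgraph \<Rightarrow> rat mat" where
  "BAt H = mat (nv H) (ne H) (\<lambda>(l, k). of_int (int (Bmat H k l) - int (Amat H k l)))"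

definition BAt_aug :: "hgraph \<Rightarrow> rat mat" where
  "BAt_aug H = mat (nv H) (ne H + 1)
     (\<lambda>(l, k). if k < ne H then of_int (int (Bmat H k l) - int (Amat H k l)) else 1)"

end

theory Submission
  imports Defs
begin

text \<open>
  Write \<open>c = v\<^sub>1 + \<dots> + v\<^sub>n\<close>. Since the vertices are orthogonal idempotents with sum \<open>1\<close>, the
  identity matrix of size \<open>m\<close> is equivalent to \<open>diag(v\<^sub>1,\<dots>,v\<^sub>1,\<dots>,v\<^sub>n,\<dots>,v\<^sub>n)\<close> with each vertex
  repeated \<open>m\<close> times, so \<open>L\<^sup>m \<cong> L\<^sup>p\<close> means \<open>[m c] = [p c]\<close>. By confluence this holds iff \<open>m c\<close> and
  \<open>p c\<close> have a common descendant under the moves \<open>M\<^sub>k\<close>, each of which adds \<open>b\<^sub>k - a\<^sub>k\<close>. A common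
  descendant with \<open>m \<noteq> p\<close> exhibits \<open>c\<close> as a rational combination of the \<open>b\<^sub>k - a\<^sub>k\<close>. Conversely, clear
  denominators in such a combination to get \<open>d c = \<Sum>\<^sub>k z\<^sub>k (b\<^sub>k - a\<^sub>k)\<close> with \<open>d > 0\<close>; for large \<open>M\<close>
  the moves with \<open>z\<^sub>k > 0\<close> applied to \<open>M c\<close> and those with \<open>z\<^sub>k < 0\<close> applied to \<open>(M + d) c\<close>
  are all defined and end at the same element.
\<close>

section \<open>Murray--von Neumann equivalence and free modules\<close>

text \<open>The label list of \<open>diagT\<close> with all multiplicities \<open>m\<close> consists
  of \<open>n\<close> blocks of length \<open>m\<close>, so position \<open>i\<close> lies in block
  \<open>i div m\<close>.\<close>

lemma concat_replicate_nth:
  "i < n * m \<Longrightarrow> concat (map (\<lambda>l. replicate m l) [0..<n]) ! i = i div m"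
proof (induction n)
  case (Suc n)
  show ?case
  proof (cases "i < n * m")
    case True
    then show ?thesis
      using Suc.IH by (simp add: nth_append length_concat comp_def sum_list_triv)
  next
    case False
    then have "i div m = n"
      using Suc.prems by (intro div_nat_eqI) (auto simp: algebra_simps)
    then show ?thesis
      using False Suc.prems by (simp add: nth_append length_concat comp_def sum_list_triv)
  qed
qed simp

context ring
begin

lemma finsum_single:
  assumes "finite A" "i \<in> A" "f i \<in> carrier R" "\<And>j. j \<in> A \<Longrightarrow> j \<noteq> i \<Longrightarrow> f j = \<zero>"
  shows "finsum R f A = f i"
proof -
  have "finsum R f A = (\<Oplus>j\<in>A. if i = j then f j else \<zero>)"
    using assms by (intro finsum_cong') auto
  also have "\<dots> = f i"
  proof (intro finsum_singleton assms(1,2))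
    show "f \<in> A \<rightarrow> carrier R"
      using assms(3,4) zero_closed by (metis Pi_I')
  qed
  finally show ?thesis .
qed

section \<open>Products of finitely supported matrices\<close>

lemma fmat_closed: "fmat R x \<Longrightarrow> x i j \<in> carrier R"
  by (simp add: fmat_def)

lemma fmatI:
  assumes "\<And>i j. x i j \<in> carrier R" "\<And>i j. M \<le> i \<or> N \<le> j \<Longrightarrow> x i j = \<zero>"
  shows "fmat R x"
proof -
  have "{(i, j). x i j \<noteq> \<zero>} \<subseteq> {..<M} \<times> {..<N}"
    using assms(2) by (auto simp: not_le[symmetric])
  then show ?thesis
    unfolding fmat_def using assms(1) by (auto intro: finite_subset)
qed

lemma fmat_bound:
  assumes "fmat R x"
  obtains N where "\<And>i j. N \<le> i \<or> N \<le> j \<Longrightarrow> x i j = \<zero>"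
proof -
  let ?S = "{(i, j). x i j \<noteq> \<zero>}"
  have "finite (fst ` ?S \<union> snd ` ?S)"
    using assms by (simp add: fmat_def)
  then obtain N where N: "\<forall>k \<in> fst ` ?S \<union> snd ` ?S. k < N"
    using finite_nat_set_iff_bounded by blast
  have "x i j = \<zero>" if "N \<le> i \<or> N \<le> j" for i j
  proof (rule ccontr)
    assume "x i j \<noteq> \<zero>"
    then have "i \<in> fst ` ?S \<union> snd ` ?S" "j \<in> fst ` ?S \<union> snd ` ?S"
      by (auto simp: image_iff)
    with N have "i < N" "j < N" by blast+
    with that show False by auto
  qed
  then show ?thesis using that by blast
qed

lemma matmul_eq_finsum:
  assumes "fmat R x" "fmat R y" "\<And>i j. N \<le> j \<Longrightarrow> x i j = \<zero>"
  shows "matmul R x y i k = (\<Oplus>j\<in>{..<N}. x i j \<otimes> y j k)"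
  unfolding matmul_def
proof (rule add.finprod_mono_neutral_cong_left)
  show "{j. \<exists>i'. x i' j \<noteq> \<zero>} \<subseteq> {..<N}"
    using assms(3) by (auto simp: not_le[symmetric])
qed (use assms(1,2) in \<open>auto simp: fmat_def\<close>)

text \<open>The index set in \<open>matmul\<close> depends on the left factor only. To use a row
  bound on \<open>y\<close> instead, sum first up to \<open>max M N\<close>, where \<open>M\<close>
  bounds \<open>x\<close>, and then drop the terms killed by \<open>y\<close>.\<close>

lemma matmul_eq_finsum':
  assumes "fmat R x" "fmat R y" "\<And>j k. N \<le> j \<Longrightarrow> y j k = \<zero>"
  shows "matmul R x y i k = (\<Oplus>j\<in>{..<N}. x i j \<otimes> y j k)"
proof -
  obtain M where M: "\<And>i j. M \<le> i \<or> M \<le> j \<Longrightarrow> x i j = \<zero>"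
    using fmat_bound[OF assms(1)] by blast
  have "matmul R x y i k = (\<Oplus>j\<in>{..<max M N}. x i j \<otimes> y j k)"
    using M by (intro matmul_eq_finsum assms(1,2)) auto
  also have "\<dots> = (\<Oplus>j\<in>{..<N}. x i j \<otimes> y j k)"
    by (rule add.finprod_mono_neutral_cong_right)
      (use assms in \<open>auto simp: fmat_def\<close>)
  finally show ?thesis .
qed

lemma fmat_matmul:
  assumes "fmat R x" "fmat R y"
  shows "fmat R (matmul R x y)"
proof -
  obtain M where M: "\<And>i j. M \<le> i \<or> M \<le> j \<Longrightarrow> x i j = \<zero>"
    using fmat_bound[OF assms(1)] by blast
  obtain N where N: "\<And>i j. N \<le> i \<or> N \<le> j \<Longrightarrow> y i j = \<zero>"
    using fmat_bound[OF assms(2)] by blast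
  have eq: "matmul R x y i k = (\<Oplus>j\<in>{..<M}. x i j \<otimes> y j k)" for i k
    using M by (intro matmul_eq_finsum assms) auto
  show ?thesis
  proof (rule fmatI[of _ M N])
    show "matmul R x y i j \<in> carrier R" for i j
      unfolding eq using assms by (auto simp: fmat_def intro!: finsum_closed)
    show "matmul R x y i j = \<zero>" if "M \<le> i \<or> N \<le> j" for i j
      unfolding eq using that M N assms by (auto simp: fmat_def intro!: add.finprod_one_eqI)
  qed
qed

text \<open>The columns of \<open>x\<close> bound the index \<open>j\<close> and the rows of
  \<open>z\<close> bound \<open>k\<close>, so both bracketings become the same finite double
  sum.\<close>

lemma matmul_assoc:
  assumes x: "fmat R x" and y: "fmat R y" and z: "fmat R z"
  shows "matmul R (matmul R x y) z = matmul R x (matmul R y z)"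
proof (intro ext)
  fix i l
  obtain M where M: "\<And>i j. M \<le> i \<or> M \<le> j \<Longrightarrow> x i j = \<zero>"
    using fmat_bound[OF x] by blast
  obtain N where N: "\<And>i j. N \<le> i \<or> N \<le> j \<Longrightarrow> z i j = \<zero>"
    using fmat_bound[OF z] by blast
  note [simp] = fmat_closed[OF x] fmat_closed[OF y] fmat_closed[OF z]
  have "matmul R (matmul R x y) z i l = (\<Oplus>k\<in>{..<N}. matmul R x y i k \<otimes> z k l)"
    using N by (intro matmul_eq_finsum' fmat_matmul x y z) auto
  also have "\<dots> = (\<Oplus>k\<in>{..<N}. (\<Oplus>j\<in>{..<M}. x i j \<otimes> y j k) \<otimes> z k l)"
    using M by (subst matmul_eq_finsum[OF x y, of M]) auto
  also have "\<dots> = (\<Oplus>k\<in>{..<N}. \<Oplus>j\<in>{..<M}. x i j \<otimes> y j k \<otimes> z k l)"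
    by (intro finsum_cong' finsum_ldistr) (auto intro!: finsum_closed)
  also have "\<dots> = (\<Oplus>j\<in>{..<M}. \<Oplus>k\<in>{..<N}. x i j \<otimes> y j k \<otimes> z k l)"
    by (intro finsum_finsum_swap) auto
  also have "\<dots> = (\<Oplus>j\<in>{..<M}. x i j \<otimes> (\<Oplus>k\<in>{..<N}. y j k \<otimes> z k l))"
    by (intro finsum_cong') (auto simp: m_assoc finsum_rdistr intro!: finsum_closed)
  also have "\<dots> = (\<Oplus>j\<in>{..<M}. x i j \<otimes> matmul R y z j l)"
    using N by (subst matmul_eq_finsum'[OF y z, of N]) auto
  also have "\<dots> = matmul R x (matmul R y z) i l"
    using M by (intro matmul_eq_finsum[symmetric] fmat_matmul x y z) auto
  finally show "matmul R (matmul R x y) z i l = matmul R x (matmul R y z) i l" .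
qed

section \<open>Murray-von Neumann equivalence of idempotents\<close>

lemma mvn_refl: "idem_mat R e \<Longrightarrow> mvn R e e"
  unfolding mvn_def idem_mat_def by metis

lemma mvn_sym: "mvn R e f \<Longrightarrow> mvn R f e"
  unfolding mvn_def by blast

text \<open>Squaring makes the witnesses compose:
  \<open>e = e e = x (y x) y = x f y = (x z) (w y)\<close>, and in the same way
  \<open>g = g g = w f z = (w y) (x z)\<close>.\<close>

lemma mvn_trans:
  assumes "idem_mat R e" "idem_mat R g" "mvn R e f" "mvn R f g"
  shows "mvn R e g"
proof -
  obtain x y where xy: "fmat R x" "fmat R y" "e = matmul R x y" "f = matmul R y x"
    using assms(3) unfolding mvn_def by blast
  obtain z w where zw: "fmat R z" "fmat R w" "f = matmul R z w" "g = matmul R w z"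
    using assms(4) unfolding mvn_def by blast
  note [simp] = xy(1,2) zw(1,2) fmat_matmul
  have "e = matmul R (matmul R x y) (matmul R x y)"
    using assms(1) xy(3) by (simp add: idem_mat_def)
  also have "\<dots> = matmul R (matmul R x f) y"
    by (simp add: xy(4) matmul_assoc)
  also have "\<dots> = matmul R (matmul R x z) (matmul R w y)"
    by (simp add: zw(3) matmul_assoc)
  finally have e: "e = matmul R (matmul R x z) (matmul R w y)" .
  have "g = matmul R (matmul R w z) (matmul R w z)"
    using assms(2) zw(4) by (simp add: idem_mat_def)
  also have "\<dots> = matmul R (matmul R w f) z"
    by (simp add: zw(3) matmul_assoc)
  also have "\<dots> = matmul R (matmul R w y) (matmul R x z)"
    by (simp add: xy(4) matmul_assoc)
  finally have "g = matmul R (matmul R w y) (matmul R x z)" .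
  with e show ?thesis
    unfolding mvn_def
    by (intro exI[of _ "matmul R x z"] exI[of _ "matmul R w y"]) simp
qed

lemma Vclass_eq_iff:
  assumes "idem_mat R e" "idem_mat R f"
  shows "Vclass R e = Vclass R f \<longleftrightarrow> mvn R e f"
proof
  assume "Vclass R e = Vclass R f"
  moreover have "f \<in> Vclass R f"
    using assms by (simp add: Vclass_def mvn_refl)
  ultimately have "f \<in> Vclass R e" by simp
  then show "mvn R e f"
    by (simp add: Vclass_def)
next
  assume "mvn R e f"
  then show "Vclass R e = Vclass R f"
    unfolding Vclass_def using assms by (blast intro: mvn_trans mvn_sym)
qed

section \<open>Diagonal matrices and padded identities\<close>

definition diagmat :: "nat \<Rightarrow> (nat \<Rightarrow> 'a) \<Rightarrow> nat \<Rightarrow> nat \<Rightarrow> 'a" where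
  "diagmat m d = (\<lambda>i j. if i = j \<and> i < m then d i else \<zero>)"

text \<open>Matrices are indexed by all naturals, so the identity of size \<open>m\<close> is an
  idempotent padded with zeros; it stands for the free module of rank \<open>m\<close>.\<close>

abbreviation idmat :: "nat \<Rightarrow> nat \<Rightarrow> nat \<Rightarrow> 'a" where
  "idmat m \<equiv> diagmat m (\<lambda>_. \<one>)"

lemma fmat_diagmat: "(\<And>i. i < m \<Longrightarrow> d i \<in> carrier R) \<Longrightarrow> fmat R (diagmat m d)"
  by (rule fmatI[of _ m m]) (auto simp: diagmat_def)

lemma matmul_diagmat_left:
  assumes "\<And>i. i < m \<Longrightarrow> d i \<in> carrier R" "fmat R x"
  shows "matmul R (diagmat m d) x i k = (if i < m then d i \<otimes> x i k else \<zero>)"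
proof -
  have "matmul R (diagmat m d) x i k = (\<Oplus>j\<in>{..<m}. diagmat m d i j \<otimes> x j k)"
    by (intro matmul_eq_finsum fmat_diagmat assms) (auto simp: diagmat_def)
  also have "\<dots> = (if i < m then d i \<otimes> x i k else \<zero>)"
    using assms fmat_closed[OF assms(2)]
    by (auto simp: diagmat_def intro!: add.finprod_one_eqI trans[OF finsum_single[where i = i]])
  finally show ?thesis .
qed

lemma matmul_diagmat_right:
  assumes "\<And>i. i < m \<Longrightarrow> d i \<in> carrier R" "fmat R x"
  shows "matmul R x (diagmat m d) i k = (if k < m then x i k \<otimes> d k else \<zero>)"
proof -
  have "matmul R x (diagmat m d) i k = (\<Oplus>j\<in>{..<m}. x i j \<otimes> diagmat m d j k)"
    by (intro matmul_eq_finsum' fmat_diagmat assms) (auto simp: diagmat_def)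
  also have "\<dots> = (if k < m then x i k \<otimes> d k else \<zero>)"
    using assms fmat_closed[OF assms(2)]
    by (auto simp: diagmat_def intro!: add.finprod_one_eqI trans[OF finsum_single[where i = k]])
  finally show ?thesis .
qed

lemma idem_mat_diagmat:
  assumes "\<And>i. i < m \<Longrightarrow> d i \<in> carrier R" "\<And>i. i < m \<Longrightarrow> d i \<otimes> d i = d i"
  shows "idem_mat R (diagmat m d)"
  unfolding idem_mat_def
proof (intro conjI ext)
  show f: "fmat R (diagmat m d)"
    using assms by (intro fmat_diagmat)
  show "matmul R (diagmat m d) (diagmat m d) i k = diagmat m d i k" for i k
    using assms matmul_diagmat_left[OF assms(1) f] by (auto simp: diagmat_def)
qed

section \<open>Linear maps of free modules and their matrices\<close>

definition unitvec :: "nat \<Rightarrow> nat \<Rightarrow> 'a" where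
  "unitvec i = (\<lambda>j. if j = i then \<one> else \<zero>)"

lemma unitvec_Lpow: "i < m \<Longrightarrow> unitvec i \<in> Lpow R m"
  by (auto simp: unitvec_def Lpow_def)

lemma Lpow_closed: "v \<in> Lpow R m \<Longrightarrow> v i \<in> carrier R"
  by (cases "i < m") (auto simp: Lpow_def)

lemma Lpow_mono: "m \<le> p \<Longrightarrow> Lpow R m \<subseteq> Lpow R p"
  using Lpow_closed[of _ m] by (auto simp: Lpow_def)

text \<open>Scalars act on the left, so a linear map multiplies row vectors on the right by the
  matrix whose rows are the images of the unit vectors.\<close>

lemma linear_map_eq_finsum:
  assumes into: "\<And>v. v \<in> Lpow R m \<Longrightarrow> f v \<in> Lpow R p"
    and add: "\<And>x y. x \<in> Lpow R m \<Longrightarrow> y \<in> Lpow R m \<Longrightarrow>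
      f (\<lambda>i. x i \<oplus> y i) = (\<lambda>i. f x i \<oplus> f y i)"
    and scale: "\<And>a x. a \<in> carrier R \<Longrightarrow> x \<in> Lpow R m \<Longrightarrow>
      f (\<lambda>i. a \<otimes> x i) = (\<lambda>i. a \<otimes> f x i)"
    and "v \<in> Lpow R m"
  shows "f v = (\<lambda>j. \<Oplus>i\<in>{..<m}. v i \<otimes> f (unitvec i) j)"
proof -
  \<comment> \<open>The induction runs over the number \<open>r\<close> of leading coordinates that
    may be nonzero, while the domain \<open>Lpow R m\<close> of \<open>f\<close> stays
    fixed.\<close>
  have "f v = (\<lambda>j. \<Oplus>i\<in>{..<r}. v i \<otimes> f (unitvec i) j)" if "r \<le> m" "v \<in> Lpow R r" for r v
    using that
  proof (induction r arbitrary: v)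
    case 0
    then have v: "v = (\<lambda>_. \<zero>)" by (auto simp: Lpow_def)
    have z: "(\<lambda>_. \<zero>) \<in> Lpow R m" by (simp add: Lpow_def)
    \<comment> \<open>Homogeneity with the scalar zero gives that \<open>f\<close> sends the zero
      vector to zero.\<close>
    have "f (\<lambda>i. \<zero> \<otimes> \<zero>) = (\<lambda>i. \<zero> \<otimes> f (\<lambda>_. \<zero>) i)"
      using scale[OF zero_closed z] .
    then show ?case
      using Lpow_closed[OF into[OF z]] by (simp add: v)
  next
    case (Suc r)
    have r: "r < m" using Suc by simp
    have vc: "v i \<in> carrier R" for i
      using Lpow_closed[OF Suc.prems(2)] .
    define v' where "v' = v(r := \<zero>)"
    have v': "v' \<in> Lpow R r"
      using Suc.prems(2) by (auto simp: v'_def Lpow_def)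
    have er: "unitvec r \<in> Lpow R m" using r by (rule unitvec_Lpow)
    have sr: "(\<lambda>i. v r \<otimes> unitvec r i) \<in> Lpow R m"
      using vc er by (auto simp: Lpow_def)
    have uc: "f (unitvec i) j \<in> carrier R" if "i < Suc r" for i j
      using Lpow_closed[OF into[OF unitvec_Lpow]] that r by auto
    have "v = (\<lambda>i. v' i \<oplus> v r \<otimes> unitvec r i)"
      using vc by (auto simp: v'_def unitvec_def)
    then have "f v = (\<lambda>j. f v' j \<oplus> v r \<otimes> f (unitvec r) j)"
      using add[OF _ sr, of v'] v' Lpow_mono[of r m] r scale[OF vc er] by auto
    also have "\<dots> = (\<lambda>j. (\<Oplus>i\<in>{..<r}. v' i \<otimes> f (unitvec i) j) \<oplus> v r \<otimes> f (unitvec r) j)"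
      using Suc.IH[OF _ v'] r by simp
    also have "\<dots> = (\<lambda>j. (\<Oplus>i\<in>{..<r}. v i \<otimes> f (unitvec i) j) \<oplus> v r \<otimes> f (unitvec r) j)"
    proof (intro ext arg_cong2[where f = "(\<oplus>)"] finsum_cong' refl)
      show "(\<lambda>i. v i \<otimes> f (unitvec i) j) \<in> {..<r} \<rightarrow> carrier R" for j
        using vc uc by auto
    qed (auto simp: v'_def)
    also have "\<dots> = (\<lambda>j. \<Oplus>i\<in>{..<Suc r}. v i \<otimes> f (unitvec i) j)"
    proof
      fix j
      show "(\<Oplus>i\<in>{..<r}. v i \<otimes> f (unitvec i) j) \<oplus> v r \<otimes> f (unitvec r) j
        = (\<Oplus>i\<in>{..<Suc r}. v i \<otimes> f (unitvec i) j)"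
        unfolding lessThan_Suc using vc uc
        by (subst finsum_insert) (auto intro!: a_comm finsum_closed)
    qed
    finally show ?case .
  qed
  then show ?thesis using assms(4) by blast
qed

text \<open>Vectors are stored as matrices supported in row 0, so that matrices act on them through
  \<open>matmul\<close> and associativity can be reused.\<close>

definition rowmat :: "(nat \<Rightarrow> 'a) \<Rightarrow> nat \<Rightarrow> nat \<Rightarrow> 'a" where
  "rowmat v = (\<lambda>i j. if i = 0 then v j else \<zero>)"

lemma fmat_rowmat: "v \<in> Lpow R m \<Longrightarrow> fmat R (rowmat v)"
  using Lpow_closed[of v m] by (intro fmatI[of _ 1 m]) (auto simp: rowmat_def Lpow_def)

lemma matmul_rowmat:
  assumes "v \<in> Lpow R m" "fmat R x"
  shows "matmul R (rowmat v) x = rowmat (\<lambda>j. \<Oplus>i\<in>{..<m}. v i \<otimes> x i j)"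
proof (intro ext)
  fix i k
  have "matmul R (rowmat v) x i k = (\<Oplus>j\<in>{..<m}. rowmat v i j \<otimes> x j k)"
    using assms by (intro matmul_eq_finsum fmat_rowmat) (auto simp: rowmat_def Lpow_def)
  then show "matmul R (rowmat v) x i k = rowmat (\<lambda>j. \<Oplus>i\<in>{..<m}. v i \<otimes> x i j) i k"
    using fmat_closed[OF assms(2)] by (auto simp: rowmat_def intro!: add.finprod_one_eqI)
qed

lemma rowmat_inject: "rowmat v = rowmat w \<Longrightarrow> v = w"
  by (auto simp: rowmat_def fun_eq_iff split: if_splits)

text \<open>Row \<open>i\<close> of \<open>x y\<close> is \<open>g\<close> applied to row
  \<open>i\<close> of \<open>x\<close>, hence \<open>g (f (unitvec i)) = unitvec i\<close>. The
  one-sided form allows a second use with \<open>f\<close> and \<open>g\<close> exchanged.\<close>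

lemma linear_iso_imp_matmul_idmat:
  assumes f: "\<And>v. v \<in> Lpow R m \<Longrightarrow> f v \<in> Lpow R p"
    and g: "\<And>v. v \<in> Lpow R p \<Longrightarrow> g v \<in> Lpow R m"
    and add: "\<And>x y. x \<in> Lpow R p \<Longrightarrow> y \<in> Lpow R p \<Longrightarrow>
      g (\<lambda>i. x i \<oplus> y i) = (\<lambda>i. g x i \<oplus> g y i)"
    and scale: "\<And>a x. a \<in> carrier R \<Longrightarrow> x \<in> Lpow R p \<Longrightarrow>
      g (\<lambda>i. a \<otimes> x i) = (\<lambda>i. a \<otimes> g x i)"
    and inv: "\<And>v. v \<in> Lpow R m \<Longrightarrow> g (f v) = v"
  defines "x \<equiv> \<lambda>i. if i < m then f (unitvec i) else (\<lambda>_. \<zero>)"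
    and "y \<equiv> \<lambda>i. if i < p then g (unitvec i) else (\<lambda>_. \<zero>)"
  shows "fmat R x" "matmul R x y = idmat m"
proof -
  have fu: "f (unitvec i) \<in> Lpow R p" if "i < m" for i
    using f unitvec_Lpow that by blast
  have gu: "g (unitvec i) \<in> Lpow R m" if "i < p" for i
    using g unitvec_Lpow that by blast
  show fx: "fmat R x"
    using fu Lpow_closed[OF fu] by (intro fmatI[of _ m p]) (auto simp: x_def Lpow_def)
  have fy: "fmat R y"
    using gu Lpow_closed[OF gu] by (intro fmatI[of _ p m]) (auto simp: y_def Lpow_def)
  show "matmul R x y = idmat m"
  proof (intro ext)
    fix i k
    have "matmul R x y i k = (\<Oplus>j\<in>{..<p}. x i j \<otimes> y j k)"
      by (intro matmul_eq_finsum' fx fy) (auto simp: y_def)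
    also have "\<dots> = idmat m i k"
    proof (cases "i < m")
      case True
      have "(\<Oplus>j\<in>{..<p}. x i j \<otimes> y j k) = (\<Oplus>j\<in>{..<p}. f (unitvec i) j \<otimes> g (unitvec j) k)"
        using True fmat_closed[OF fx] fmat_closed[OF fy] Lpow_closed[OF fu[OF True]] Lpow_closed[OF gu]
        by (intro finsum_cong') (auto simp: x_def y_def)
      also have "\<dots> = g (f (unitvec i)) k"
        by (subst linear_map_eq_finsum[of p g m "f (unitvec i)"]) (use g add scale fu True in auto)
      also have "\<dots> = unitvec i k"
        using inv[OF unitvec_Lpow[OF True]] by simp
      finally show ?thesis
        using True by (auto simp: unitvec_def diagmat_def)
    next
      case False
      then show ?thesis
        using fmat_closed[OF fy] by (auto simp: x_def diagmat_def intro!: add.finprod_one_eqI)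
    qed
    finally show "matmul R x y i k = idmat m i k" .
  qed
qed

text \<open>The two factors are the matrices of the isomorphism and of its inverse.
  \<open>free_mod_iso\<close> supplies only a linear bijection, so linearity of the inverse is
  derived first by applying \<open>f\<close> and cancelling.\<close>

lemma free_mod_iso_imp_mvn:
  assumes "free_mod_iso R m p"
  shows "mvn R (idmat m) (idmat p)"
proof -
  obtain f where bij: "bij_betw f (Lpow R m) (Lpow R p)"
    and add: "\<And>x y. x \<in> Lpow R m \<Longrightarrow> y \<in> Lpow R m \<Longrightarrow>
      f (\<lambda>i. x i \<oplus> y i) = (\<lambda>i. f x i \<oplus> f y i)"
    and scale: "\<And>a x. a \<in> carrier R \<Longrightarrow> x \<in> Lpow R m \<Longrightarrow>
      f (\<lambda>i. a \<otimes> x i) = (\<lambda>i. a \<otimes> f x i)"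
    using assms unfolding free_mod_iso_def by blast
  define g where "g = inv_into (Lpow R m) f"
  have f: "f v \<in> Lpow R p" if "v \<in> Lpow R m" for v
    using bij that by (auto simp: bij_betw_def)
  have g: "g v \<in> Lpow R m" if "v \<in> Lpow R p" for v
    using bij that unfolding g_def by (metis bij_betw_imp_surj_on inv_into_into)
  have gf: "g (f v) = v" if "v \<in> Lpow R m" for v
    using bij that unfolding g_def by (simp add: bij_betw_inv_into_left)
  have fg: "f (g v) = v" if "v \<in> Lpow R p" for v
    using bij that unfolding g_def by (simp add: bij_betw_inv_into_right)
  have gadd: "g (\<lambda>i. x i \<oplus> y i) = (\<lambda>i. g x i \<oplus> g y i)"
    if "x \<in> Lpow R p" "y \<in> Lpow R p" for x y
  proof -
    have "(\<lambda>i. g x i \<oplus> g y i) \<in> Lpow R m"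
      using g[OF that(1)] g[OF that(2)] by (auto simp: Lpow_def)
    moreover have "f (\<lambda>i. g x i \<oplus> g y i) = (\<lambda>i. x i \<oplus> y i)"
      using add[OF g g] that fg by simp
    ultimately show ?thesis using gf by metis
  qed
  have gscale: "g (\<lambda>i. a \<otimes> x i) = (\<lambda>i. a \<otimes> g x i)"
    if "a \<in> carrier R" "x \<in> Lpow R p" for a x
  proof -
    have "(\<lambda>i. a \<otimes> g x i) \<in> Lpow R m"
      using g[OF that(2)] that(1) by (auto simp: Lpow_def)
    moreover have "f (\<lambda>i. a \<otimes> g x i) = (\<lambda>i. a \<otimes> x i)"
      using scale[OF _ g] that fg by simp
    ultimately show ?thesis using gf by metis
  qed
  define x where "x = (\<lambda>i. if i < m then f (unitvec i) else (\<lambda>_. \<zero>))"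
  define y where "y = (\<lambda>i. if i < p then g (unitvec i) else (\<lambda>_. \<zero>))"
  have X: "fmat R x" "matmul R x y = idmat m"
    unfolding x_def y_def by (rule linear_iso_imp_matmul_idmat[of m f p g]; fact f g gadd gscale gf)+
  have Y: "fmat R y" "matmul R y x = idmat p"
    unfolding x_def y_def by (rule linear_iso_imp_matmul_idmat[of p g m f]; fact g f add scale fg)+
  show ?thesis
    unfolding mvn_def using X Y by (intro exI[of _ x] exI[of _ y]) simp
qed

text \<open>After restriction to the corners, the two factors act on row vectors by right
  multiplication as mutually inverse module maps.\<close>

lemma mvn_imp_free_mod_iso:
  assumes "mvn R (idmat m) (idmat p)"
  shows "free_mod_iso R m p"
proof -
  obtain x0 y0 where 0: "fmat R x0" "fmat R y0" "idmat m = matmul R x0 y0" "idmat p = matmul R y0 x0"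
    using assms unfolding mvn_def by blast
  \<comment> \<open>Cutting down to the corners makes the matrices \<open>m \<times> p\<close> and \<open>p \<times> m\<close>.\<close>
  define x where "x = matmul R (idmat m) x0"
  define y where "y = matmul R (idmat p) y0"
  have fi: "fmat R (idmat q)" for q by (simp add: fmat_diagmat)
  note [simp] = 0(1,2) fi fmat_matmul
  \<comment> \<open>Both sides are \<open>x0 y0 x0\<close>: cutting the rows at \<open>m\<close> is
    the same as cutting the columns at \<open>p\<close>.\<close>
  have x: "x = matmul R x0 (idmat p)"
    by (simp add: x_def 0(3,4) matmul_assoc)
  have y: "y = matmul R y0 (idmat m)"
    by (simp add: y_def 0(3,4) matmul_assoc)
  have fx: "fmat R x" and fy: "fmat R y"
    by (simp_all add: x_def y_def)
  have idem: "matmul R (idmat q) (idmat q) = idmat q" for q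
    using idem_mat_diagmat[of q "\<lambda>_. \<one>"] by (simp add: idem_mat_def)
  have xy: "matmul R x y = idmat m"
  proof -
    have "matmul R x y = matmul R (idmat m) (matmul R (matmul R x0 y0) (idmat m))"
      by (simp add: x_def y matmul_assoc)
    then show ?thesis by (simp add: 0(3)[symmetric] idem)
  qed
  have yx: "matmul R y x = idmat p"
  proof -
    have "matmul R y x = matmul R (idmat p) (matmul R (matmul R y0 x0) (idmat p))"
      by (simp add: y_def x matmul_assoc)
    then show ?thesis by (simp add: 0(4)[symmetric] idem)
  qed
  have xz: "x i j = \<zero>" if "p \<le> j" for i j
    using that unfolding x by (subst matmul_diagmat_right) auto
  have yz: "y i j = \<zero>" if "m \<le> j" for i j
    using that unfolding y by (subst matmul_diagmat_right) auto
  define act where "act q z v = (\<lambda>j. \<Oplus>i\<in>{..<q}. v i \<otimes> z i j)" for q and z :: "nat \<Rightarrow> nat \<Rightarrow> 'a" and v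
  have act_Lpow: "act q z v \<in> Lpow R r"
    if "fmat R z" "\<And>i j. r \<le> j \<Longrightarrow> z i j = \<zero>" "v \<in> Lpow R q" for q r z v
    using that Lpow_closed[OF that(3)] fmat_closed[OF that(1)]
    by (auto simp: act_def Lpow_def intro!: add.finprod_one_eqI finsum_closed)
  \<comment> \<open>Two successive actions are one action by the product \<open>z w\<close>, which
    is associativity once the vector is written as \<open>rowmat v\<close>.\<close>
  have act_act: "act r w (act q z v) = v"
    if "fmat R z" "fmat R w" "\<And>i j. r \<le> j \<Longrightarrow> z i j = \<zero>" "v \<in> Lpow R q" "matmul R z w = idmat q"
    for q r z w v
  proof -
    have "rowmat (act r w (act q z v)) = matmul R (matmul R (rowmat v) z) w"
      using that act_Lpow[OF that(1,3,4)] by (simp add: matmul_rowmat[symmetric] act_def)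
    also have "\<dots> = matmul R (rowmat v) (idmat q)"
      using that fmat_rowmat[OF that(4)] by (simp add: matmul_assoc)
    also have "\<dots> = rowmat v"
      using that(4) Lpow_closed[OF that(4)] fmat_rowmat[OF that(4)]
      by (intro ext) (auto simp: matmul_diagmat_right rowmat_def Lpow_def)
    finally show ?thesis by (rule rowmat_inject)
  qed
  have "bij_betw (act m x) (Lpow R m) (Lpow R p)"
    by (rule bij_betwI[where g = "act p y"])
      (auto intro!: act_Lpow act_act fx fy xz yz xy yx)
  moreover have "act m x (\<lambda>i. v i \<oplus> w i) = (\<lambda>i. act m x v i \<oplus> act m x w i)"
    if "v \<in> Lpow R m" "w \<in> Lpow R m" for v w
    unfolding act_def
    using Lpow_closed[OF that(1)] Lpow_closed[OF that(2)] fmat_closed[OF fx]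
    by (intro ext) (simp add: l_distr finsum_addf)
  moreover have "act m x (\<lambda>i. a \<otimes> v i) = (\<lambda>i. a \<otimes> act m x v i)"
    if "a \<in> carrier R" "v \<in> Lpow R m" for a v
    unfolding act_def
    using Lpow_closed[OF that(2)] fmat_closed[OF fx] that(1)
    by (intro ext) (simp add: m_assoc finsum_rdistr)
  ultimately show ?thesis
    unfolding free_mod_iso_def by blast
qed

section \<open>Free modules and the classes of multiples of the vertex sum\<close>

lemma diagT_const:
  "diagT R vs n (\<lambda>l. if l < n then m else 0) = diagmat (n * m) (\<lambda>i. vs (i div m))"
proof -
  have "concat (map (\<lambda>l. replicate (if l < n then m else 0) l) [0..<n])
      = concat (map (\<lambda>l. replicate m l) [0..<n])"
    by (intro arg_cong[of _ _ concat] map_cong) auto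
  moreover have "length (concat (map (\<lambda>l. replicate m l) [0..<n])) = n * m"
    by (simp add: length_concat comp_def sum_list_triv)
  ultimately show ?thesis
    unfolding diagT_def diagmat_def Let_def by (auto simp: concat_replicate_nth intro!: ext)
qed

text \<open>The witnesses unfold the unit into vertices: \<open>P\<close> has size \<open>m\<close>
  by \<open>n * m\<close>, with entry \<open>vs l\<close> at row \<open>t\<close> and column
  \<open>l * m + t\<close>, and \<open>Q\<close> is its transpose. Diagonal entries of
  \<open>P Q\<close> are the full sum of the \<open>vs l\<close>, that is \<open>\<one>\<close>; in
  \<open>Q P\<close> orthogonality leaves only the diagonal.\<close>

lemma mvn_idmat_diagmat:
  assumes vs: "\<And>l. l < n \<Longrightarrow> vs l \<in> carrier R"
    and orth: "\<And>l l'. l < n \<Longrightarrow> l' < n \<Longrightarrow> vs l \<otimes> vs l' = (if l = l' then vs l else \<zero>)"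
    and one: "(\<Oplus>l\<in>{..<n}. vs l) = \<one>"
  shows "mvn R (idmat m) (diagmat (n * m) (\<lambda>i. vs (i div m)))"
proof -
  define P where "P = (\<lambda>t i. if i < n * m \<and> i mod m = t then vs (i div m) else \<zero>)"
  define Q where "Q = (\<lambda>i t. P t i)"
  have div: "i div m < n" if "i < n * m" for i
    using that by (simp add: less_mult_imp_div_less)
  have md: "i mod m < m" if "i < n * m" for i
    using that by (cases m) auto
  have Pc: "P t i \<in> carrier R" for t i
    using div vs by (auto simp: P_def)
  have fP: "fmat R P"
    using Pc md by (intro fmatI[of _ m "n * m"]) (auto simp: P_def not_less[symmetric])
  have fQ: "fmat R Q"
    using Pc md by (intro fmatI[of _ "n * m" m]) (auto simp: Q_def P_def not_less[symmetric])
  have "matmul R P Q t u = idmat m t u" for t u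
  proof -
    have "matmul R P Q t u = (\<Oplus>i\<in>{..<n*m}. P t i \<otimes> P u i)"
      by (subst matmul_eq_finsum[OF fP fQ, of "n * m"]) (auto simp: P_def Q_def)
    also have "\<dots> = idmat m t u"
    proof (cases "t = u \<and> t < m")
      case True
      \<comment> \<open>Row \<open>t\<close> of \<open>P\<close> vanishes off the columns with
        remainder \<open>t\<close> modulo \<open>m\<close>; these are the indices
        \<open>l * m + t\<close>, one for each vertex.\<close>
      have "(\<Oplus>i\<in>{..<n*m}. P t i \<otimes> P u i) = (\<Oplus>i\<in>(\<lambda>l. l * m + t) ` {..<n}. vs (i div m))"
      proof (rule add.finprod_mono_neutral_cong_right)
        show sub: "(\<lambda>l. l * m + t) ` {..<n} \<subseteq> {..<n * m}"
        proof (clarsimp)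
          fix l assume "l < n"
          then have "(l + 1) * m \<le> n * m" by (intro mult_right_mono) auto
          then show "l * m + t < n * m" using True by (simp add: algebra_simps)
        qed
        show "P t i \<otimes> P u i = \<zero>" if "i \<in> {..<n*m} - (\<lambda>l. l * m + t) ` {..<n}" for i
        proof -
          have "i mod m \<noteq> t"
            using that div[of i] by (auto simp: image_iff) (metis div_mult_mod_eq lessThan_iff)
          then have "P t i = \<zero>" by (simp add: P_def)
          then show ?thesis using Pc by simp
        qed
        show "P t i \<otimes> P u i = vs (i div m)" if "i \<in> (\<lambda>l. l * m + t) ` {..<n}" for i
          using that sub True orth by (auto simp: P_def)
      qed (use Pc in auto)
      also have "\<dots> = (\<Oplus>l\<in>{..<n}. vs ((l * m + t) div m))"
        using True vs by (intro finsum_reindex) (auto simp: inj_on_def)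
      also have "\<dots> = (\<Oplus>l\<in>{..<n}. vs l)"
        using True vs by (intro finsum_cong') auto
      finally show ?thesis using True one by (auto simp: diagmat_def)
    next
      case False
      have "P t i \<otimes> P u i = \<zero>" if "i < n * m" for i
        using False md[OF that] div[OF that] vs by (auto simp: P_def)
      then show ?thesis
        using False by (auto simp: diagmat_def intro!: add.finprod_one_eqI)
    qed
    finally show ?thesis .
  qed
  moreover have "matmul R Q P i k = diagmat (n * m) (\<lambda>i. vs (i div m)) i k" for i k
  proof -
    have "matmul R Q P i k = (\<Oplus>t\<in>{..<m}. P t i \<otimes> P t k)"
      using md by (subst matmul_eq_finsum[OF fQ fP, of m]) (auto simp: P_def Q_def not_less[symmetric])
    also have "\<dots> = diagmat (n * m) (\<lambda>i. vs (i div m)) i k"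
    proof (cases "i < n * m \<and> k < n * m \<and> i mod m = k mod m")
      case True
      have "(\<Oplus>t\<in>{..<m}. P t i \<otimes> P t k) = P (i mod m) i \<otimes> P (i mod m) k"
      proof (rule finsum_single)
        show "P (i mod m) i \<otimes> P (i mod m) k \<in> carrier R" using Pc by simp
        show "P t i \<otimes> P t k = \<zero>" if "t \<noteq> i mod m" for t
          using that Pc by (simp add: P_def)
      qed (use True md in auto)
      also have "\<dots> = (if i div m = k div m then vs (i div m) else \<zero>)"
        using True orth div by (auto simp: P_def)
      \<comment> \<open>The remainders already agree in this case, so equal quotients force equal
        indices.\<close>
      also have "i div m = k div m \<longleftrightarrow> i = k"
        using True by (metis div_mult_mod_eq)
      finally show ?thesis using True by (simp add: diagmat_def)
    next
      case False
      then have "P t i \<otimes> P t k = \<zero>" for t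
        using Pc vs div by (auto simp: P_def)
      with False show ?thesis
        by (auto simp: diagmat_def intro!: add.finprod_one_eqI)
    qed
    finally show ?thesis .
  qed
  ultimately show ?thesis
    unfolding mvn_def using fP fQ by (intro exI[of _ P] exI[of _ Q]) (auto intro!: ext)
qed

text \<open>Both identities are replaced by their vertex diagonals through
  \<open>mvn_idmat_diagmat\<close>; transitivity then carries an equivalence in either
  direction.\<close>

lemma free_mod_iso_iff_Vclass:
  assumes vs: "\<And>l. l < n \<Longrightarrow> vs l \<in> carrier R"
    and orth: "\<And>l l'. l < n \<Longrightarrow> l' < n \<Longrightarrow> vs l \<otimes> vs l' = (if l = l' then vs l else \<zero>)"
    and one: "(\<Oplus>l\<in>{..<n}. vs l) = \<one>"
  shows "free_mod_iso R m p \<longleftrightarrow>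
    Vclass R (diagT R vs n (\<lambda>l. if l < n then m else 0)) =
    Vclass R (diagT R vs n (\<lambda>l. if l < n then p else 0))"
proof -
  let ?d = "\<lambda>q. diagmat (n * q) (\<lambda>i. vs (i div q))"
  have id: "idem_mat R (?d q)" for q
    using vs orth by (intro idem_mat_diagmat) (auto simp: less_mult_imp_div_less)
  have ii: "idem_mat R (idmat q)" for q
    by (intro idem_mat_diagmat) auto
  have mv: "mvn R (idmat q) (?d q)" for q
    using assms by (rule mvn_idmat_diagmat)
  have "mvn R (idmat m) (idmat p) \<Longrightarrow> mvn R (?d m) (?d p)"
    by (rule mvn_trans[OF id id mvn_sym[OF mv] mvn_trans[OF ii id _ mv]])
  moreover have "mvn R (?d m) (?d p) \<Longrightarrow> mvn R (idmat m) (idmat p)"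
    by (rule mvn_trans[OF ii ii mv mvn_trans[OF id ii _ mvn_sym[OF mv]]])
  moreover have "free_mod_iso R m p \<longleftrightarrow> mvn R (idmat m) (idmat p)"
    using free_mod_iso_imp_mvn mvn_imp_free_mod_iso by blast
  ultimately have "free_mod_iso R m p \<longleftrightarrow> mvn R (?d m) (?d p)"
    by blast
  then show ?thesis
    unfolding diagT_const by (simp add: Vclass_eq_iff id)
qed

end

section \<open>The algebra of a hypergraph is a unital ring\<close>

lemma fa_carrier_zero: "0 \<in> fa_carrier H"
  by (simp add: fa_carrier_def)

lemma fa_carrier_add:
  assumes "f \<in> fa_carrier H" "g \<in> fa_carrier H"
  shows "f + g \<in> fa_carrier H"
proof -
  have "{w. (f + g) w \<noteq> 0} \<subseteq> {w. f w \<noteq> 0} \<union> {w. g w \<noteq> 0}" by auto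
  then have "finite {w. (f + g) w \<noteq> 0}"
    by (rule finite_subset) (use assms in \<open>simp add: fa_carrier_def\<close>)
  moreover have "w \<noteq> [] \<and> (\<forall>x\<in>set w. valid_gen H x)" if "(f + g) w \<noteq> 0" for w
  proof -
    have "f w \<noteq> 0 \<or> g w \<noteq> 0" using that by auto
    then show ?thesis using assms unfolding fa_carrier_def by blast
  qed
  ultimately show ?thesis by (simp add: fa_carrier_def)
qed

lemma fa_carrier_smult:
  assumes "f \<in> fa_carrier H"
  shows "(\<lambda>w. c * f w) \<in> fa_carrier H"
proof -
  have "{w. c * f w \<noteq> 0} \<subseteq> {w. f w \<noteq> 0}" by auto
  then have "finite {w. c * f w \<noteq> 0}"
    by (rule finite_subset) (use assms in \<open>simp add: fa_carrier_def\<close>)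
  then show ?thesis using assms by (auto simp: fa_carrier_def)
qed

lemma fa_carrier_uminus: "f \<in> fa_carrier H \<Longrightarrow> - f \<in> fa_carrier H"
  using fa_carrier_smult[of f H "-1"] by (simp add: fun_Compl_def)

lemma fa_carrier_diff: "f \<in> fa_carrier H \<Longrightarrow> g \<in> fa_carrier H \<Longrightarrow> f - g \<in> fa_carrier H"
  using fa_carrier_add[OF _ fa_carrier_uminus, of f H g] by simp

lemma fa_carrier_sum:
  "(\<And>i. i \<in> A \<Longrightarrow> f i \<in> fa_carrier H) \<Longrightarrow> sum f A \<in> fa_carrier H"
  by (induction A rule: infinite_finite_induct) (auto simp: fa_carrier_zero fa_carrier_add)

lemma fa_carrier_monom:
  "w \<noteq> [] \<Longrightarrow> (\<And>x. x \<in> set w \<Longrightarrow> valid_gen H x) \<Longrightarrow> monom w c \<in> fa_carrier H"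
  by (auto simp: fa_carrier_def monom_def)

lemma vsum_carrier: "vsum H \<in> fa_carrier H"
  unfolding vsum_def by (intro fa_carrier_sum fa_carrier_monom) auto

text \<open>Every word in the support of the product is a concatenation of words from the two
  supports, which gives finiteness and validity of its letters.\<close>

lemma fa_mult_carrier:
  assumes "f \<in> fa_carrier H" "g \<in> fa_carrier H"
  shows "fa_mult f g \<in> fa_carrier H"
proof -
  have *: "\<exists>u v. w = u @ v \<and> f u \<noteq> 0 \<and> g v \<noteq> 0" if "fa_mult f g w \<noteq> 0" for w
  proof -
    from that have "(\<Sum>i\<in>{1..<length w}. f (take i w) * g (drop i w)) \<noteq> 0"
      by (simp add: fa_mult_def)
    then obtain i where "f (take i w) * g (drop i w) \<noteq> 0"
      by (rule sum.not_neutral_contains_not_neutral)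
    then show ?thesis
      by (intro exI[of _ "take i w"] exI[of _ "drop i w"]) simp
  qed
  then have "{w. fa_mult f g w \<noteq> 0} \<subseteq> (\<lambda>(u, v). u @ v) ` ({u. f u \<noteq> 0} \<times> {v. g v \<noteq> 0})"
    by fast
  then have "finite {w. fa_mult f g w \<noteq> 0}"
    by (rule finite_subset) (use assms in \<open>simp add: fa_carrier_def\<close>)
  moreover have "w \<noteq> [] \<and> (\<forall>x\<in>set w. valid_gen H x)" if "fa_mult f g w \<noteq> 0" for w
    using *[OF that] assms unfolding fa_carrier_def by fastforce
  ultimately show ?thesis by (simp add: fa_carrier_def)
qed

lemma fa_mult_add_left: "fa_mult (f + g) h = fa_mult f h + fa_mult g h"
  by (auto simp: fa_mult_def fun_eq_iff sum.distrib algebra_simps)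

lemma fa_mult_add_right: "fa_mult h (f + g) = fa_mult h f + fa_mult h g"
  by (auto simp: fa_mult_def fun_eq_iff sum.distrib algebra_simps)

lemma fa_mult_diff_left: "fa_mult (f - g) h = fa_mult f h - fa_mult g h"
  by (auto simp: fa_mult_def fun_eq_iff sum_subtractf algebra_simps)

lemma fa_mult_diff_right: "fa_mult h (f - g) = fa_mult h f - fa_mult h g"
  by (auto simp: fa_mult_def fun_eq_iff sum_subtractf algebra_simps)

lemma fa_mult_zero_left [simp]: "fa_mult 0 h = 0"
  by (auto simp: fa_mult_def fun_eq_iff)

lemma fa_mult_zero_right [simp]: "fa_mult h 0 = 0"
  by (auto simp: fa_mult_def fun_eq_iff)

lemma fa_mult_sum_left: "fa_mult (sum f A) h = (\<Sum>i\<in>A. fa_mult (f i) h)"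
  using sum_comp_morphism[of "\<lambda>f. fa_mult f h" f A] by (simp add: fa_mult_add_left comp_def)

lemma fa_mult_sum_right: "fa_mult h (sum f A) = (\<Sum>i\<in>A. fa_mult h (f i))"
  using sum_comp_morphism[of "fa_mult h" f A] by (simp add: fa_mult_add_right comp_def)

text \<open>Both sides sum over pairs of cut points \<open>1 \<le> j < i < n\<close> of the word;
  \<open>F (j, i)\<close> is the contribution of the three resulting pieces.\<close>

lemma fa_mult_assoc: "fa_mult (fa_mult f g) h = fa_mult f (fa_mult g h)"
proof
  fix w :: "gen list"
  define n where "n = length w"
  define F where "F = (\<lambda>(j, i). f (take j w) * g (drop j (take i w)) * h (drop i w))"
  have "fa_mult (fa_mult f g) h w = (\<Sum>i\<in>{1..<n}. \<Sum>j\<in>{1..<i}. F (j, i))"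
    unfolding fa_mult_def F_def n_def
    by (intro sum.cong refl) (auto simp: sum_distrib_right min_def intro!: sum.cong)
  also have "\<dots> = (\<Sum>i\<in>{1..<n}. \<Sum>j\<in>{1..<n}. if j < i then F (j, i) else 0)"
    by (intro sum.cong refl sum.mono_neutral_cong_left) auto
  also have "\<dots> = (\<Sum>j\<in>{1..<n}. \<Sum>i\<in>{1..<n}. if j < i then F (j, i) else 0)"
    by (rule sum.swap)
  \<comment> \<open>The range is written so that it can be shifted by \<open>j\<close>: afterwards
    the second cut is measured inside \<open>drop j w\<close>.\<close>
  also have "\<dots> = (\<Sum>j\<in>{1..<n}. \<Sum>i\<in>{1+j..<(n-j)+j}. F (j, i))"
    by (intro sum.cong refl sum.mono_neutral_cong_right) auto
  also have "\<dots> = (\<Sum>j\<in>{1..<n}. \<Sum>i\<in>{1..<n-j}. F (j, i + j))"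
    by (subst sum.shift_bounds_nat_ivl) simp
  also have "\<dots> = fa_mult f (fa_mult g h) w"
    unfolding fa_mult_def F_def n_def
    by (intro sum.cong refl) (auto simp: sum_distrib_left mult.assoc drop_take intro!: sum.cong)
  finally show "fa_mult (fa_mult f g) h w = fa_mult f (fa_mult g h) w" .
qed

text \<open>\<open>fa_mult\<close> cuts words at interior positions only, hence the nonemptiness
  assumptions; the only contributing cut is the one after \<open>length u\<close> letters.\<close>

lemma fa_mult_monom:
  assumes "u \<noteq> []" "v \<noteq> []"
  shows "fa_mult (monom u c) (monom v d) = monom (u @ v) (c * d)"
proof
  fix w
  show "fa_mult (monom u c) (monom v d) w = monom (u @ v) (c * d) w"
  proof (cases "w = u @ v")
    case True
    have "fa_mult (monom u c) (monom v d) w = (\<Sum>i\<in>{length u}. monom u c (take i w) * monom v d (drop i w))"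
      unfolding fa_mult_def
    proof (rule sum.mono_neutral_right)
      show "{length u} \<subseteq> {1..<length w}"
        using assms True by (auto simp: Suc_le_eq)
      show "\<forall>i\<in>{1..<length w} - {length u}. monom u c (take i w) * monom v d (drop i w) = 0"
      proof
        fix i assume i: "i \<in> {1..<length w} - {length u}"
        then have "length (take i w) = i" by simp
        then have "take i w \<noteq> u" using i by auto
        then show "monom u c (take i w) * monom v d (drop i w) = 0" by (simp add: monom_def)
      qed
    qed simp
    then show ?thesis using True by (simp add: monom_def)
  next
    case False
    have "monom u c (take i w) * monom v d (drop i w) = 0" for i
      using False append_take_drop_id[of i w] by (auto simp: monom_def)
    then show ?thesis using False by (simp add: fa_mult_def monom_def)
  qed
qed

text \<open>An element of the carrier is the finite sum of its monomials, so statements stable under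
  addition need checking only on monomials.\<close>

lemma fa_carrier_induct [consumes 1, case_names zero add monom]:
  fixes f :: "gen list \<Rightarrow> 'k::field"
  assumes "f \<in> fa_carrier H"
    and "P 0" "\<And>f g. P f \<Longrightarrow> P g \<Longrightarrow> P (f + g)"
    and "\<And>w c. w \<noteq> [] \<Longrightarrow> (\<And>x. x \<in> set w \<Longrightarrow> valid_gen H x) \<Longrightarrow> P (monom w c)"
  shows "P f"
proof -
  let ?S = "{w. f w \<noteq> 0}"
  have fin: "finite ?S" using assms(1) by (simp add: fa_carrier_def)
  have "f = (\<Sum>w\<in>?S. monom w (f w))"
  proof
    fix u
    have "(\<Sum>w\<in>?S. monom w (f w)) u = (\<Sum>w\<in>?S. monom w (f w) u)"
      using fin by (induction rule: finite_induct) auto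
    also have "\<dots> = f u"
      using fin by (simp add: monom_def)
    finally show "f u = (\<Sum>w\<in>?S. monom w (f w)) u" by simp
  qed
  moreover have "P (\<Sum>w\<in>A. monom w (f w))" if "finite A" "A \<subseteq> ?S" for A
    using that
  proof (induction rule: finite_induct)
    case (insert w A)
    then have "P (monom w (f w))"
      using assms(1) by (intro assms(4)) (auto simp: fa_carrier_def)
    moreover have "P (\<Sum>w\<in>A. monom w (f w))" using insert by auto
    ultimately show ?case
      unfolding sum.insert[OF insert.hyps] by (rule assms(3))
  qed (simp add: assms(2))
  ultimately show ?thesis using fin by (metis subset_refl)
qed

section \<open>The defining ideal, its cosets and the quotient operations\<close>

lemma hideal_uminus: "x \<in> hideal H \<Longrightarrow> - x \<in> hideal H"
  using hideal.smult[of x H "-1"] by (simp add: fun_Compl_def)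

lemma hideal_diff: "x \<in> hideal H \<Longrightarrow> y \<in> hideal H \<Longrightarrow> x - y \<in> hideal H"
  using hideal.add[OF _ hideal_uminus, of x H y] by simp

lemma hideal_sum: "(\<And>i. i \<in> A \<Longrightarrow> f i \<in> hideal H) \<Longrightarrow> sum f A \<in> hideal H"
  by (induction A rule: infinite_finite_induct) (auto intro: hideal.zero hideal.add)

lemma hrels_carrier:
  assumes "finite_hypergraph H" "x \<in> hrels H"
  shows "x \<in> fa_carrier H"
  using assms unfolding hrels_def finite_hypergraph_def
  by (auto intro!: fa_carrier_diff fa_carrier_sum fa_carrier_monom fa_carrier_zero)

lemma hideal_carrier:
  assumes "finite_hypergraph H" "x \<in> hideal H"
  shows "x \<in> fa_carrier H"
  using assms(2)
  by induction (assumption | rule hrels_carrier[OF assms(1)] fa_carrier_zero fa_carrier_add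
      fa_carrier_smult fa_mult_carrier)+

text \<open>The residue class of \<open>a\<close>, written without the ring record, so that equality
  in the quotient becomes membership in \<open>hideal\<close>.\<close>

definition hcos :: "hgraph \<Rightarrow> (gen list \<Rightarrow> 'k::field) \<Rightarrow> (gen list \<Rightarrow> 'k) set" where
  "hcos H a = {x. x - a \<in> hideal H}"

lemma a_r_coset_FA: "a_r_coset (FA H) (hideal H) a = hcos H a"
proof -
  have "x \<in> a_r_coset (FA H) (hideal H) a \<longleftrightarrow> x \<in> hcos H a" for x
    by (auto simp: a_r_coset_def r_coset_def FA_def hcos_def intro!: bexI[of _ "x - a"])
  then show ?thesis by blast
qed

lemma hcos_eq_iff: "hcos H a = hcos H b \<longleftrightarrow> a - b \<in> hideal H"
proof
  assume "hcos H a = hcos H b"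
  moreover have "a \<in> hcos H a" by (simp add: hcos_def hideal.zero)
  ultimately show "a - b \<in> hideal H" by (simp add: hcos_def)
next
  assume ab: "a - b \<in> hideal H"
  have "x - a \<in> hideal H \<longleftrightarrow> x - b \<in> hideal H" for x
    using hideal.add[OF _ ab, of "x - a"] hideal_diff[OF _ ab, of "x - b"]
    by (auto simp: algebra_simps)
  then show "hcos H a = hcos H b" by (simp add: hcos_def)
qed

lemma carrier_LK: "carrier (LK H) = hcos H ` fa_carrier H"
proof -
  have "carrier (LK H) = (\<Union>a\<in>fa_carrier H. {a_r_coset (FA H) (hideal H) a})"
    by (simp add: LK_def FactRing_def A_RCOSETS_def RCOSETS_def a_r_coset_def) (simp add: FA_def)
  then show ?thesis unfolding a_r_coset_FA by auto
qed

lemma zero_LK: "\<zero>\<^bsub>LK H\<^esub> = hcos H 0"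
  by (simp add: LK_def FactRing_def hcos_def)

lemma one_LK: "\<one>\<^bsub>LK H\<^esub> = hcos H (vsum H)"
  by (simp add: LK_def FactRing_def a_r_coset_FA) (simp add: FA_def)

lemma vtx_eq_hcos: "vtx H v = hcos H (monom [V v] 1)"
  by (simp add: vtx_def a_r_coset_FA)

lemma add_LK: "hcos H a \<oplus>\<^bsub>LK H\<^esub> hcos H b = hcos H (a + b)"
proof -
  have "hcos H a \<oplus>\<^bsub>LK H\<^esub> hcos H b = {x + y | x y. x \<in> hcos H a \<and> y \<in> hcos H b}"
    by (auto simp: LK_def FactRing_def set_add_def set_mult_def FA_def)
  also have "\<dots> = hcos H (a + b)"
  proof (intro equalityI subsetI)
    fix z assume "z \<in> {x + y | x y. x \<in> hcos H a \<and> y \<in> hcos H b}"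
    then obtain x y where "z = x + y" "x - a \<in> hideal H" "y - b \<in> hideal H"
      by (auto simp: hcos_def)
    then show "z \<in> hcos H (a + b)"
      using hideal.add[of "x - a" H "y - b"] by (simp add: hcos_def algebra_simps)
  next
    fix z assume "z \<in> hcos H (a + b)"
    then have "z = (z - b) + b" "z - b \<in> hcos H a" "b \<in> hcos H b"
      by (auto simp: hcos_def algebra_simps hideal.zero)
    then show "z \<in> {x + y | x y. x \<in> hcos H a \<and> y \<in> hcos H b}" by blast
  qed
  finally show ?thesis .
qed

text \<open>The product in \<open>FactRing\<close> is a union over all representatives. It collapses
  to one coset because \<open>x y - a b = (x - a) y + a (y - b)\<close> lies in the ideal.\<close>

lemma mult_LK:
  assumes H: "finite_hypergraph H" and a: "a \<in> fa_carrier H" and b: "b \<in> fa_carrier H"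
  shows "hcos H a \<otimes>\<^bsub>LK H\<^esub> hcos H b = hcos H (fa_mult a b)"
proof -
  have eq: "hcos H a \<otimes>\<^bsub>LK H\<^esub> hcos H b = (\<Union>x\<in>hcos H a. \<Union>y\<in>hcos H b. hcos H (fa_mult x y))"
    by (simp add: LK_def FactRing_def rcoset_mult_def a_r_coset_FA) (simp add: FA_def)
  have "hcos H (fa_mult x y) = hcos H (fa_mult a b)" if "x \<in> hcos H a" "y \<in> hcos H b" for x y
  proof -
    have xa: "x - a \<in> hideal H" and yb: "y - b \<in> hideal H" using that by (auto simp: hcos_def)
    \<comment> \<open>Closure of \<open>hideal\<close> under products is available only for factors
      in the carrier; \<open>y\<close> differs from \<open>b\<close> by an ideal element, which lies
      there too.\<close>
    have "y \<in> fa_carrier H"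
      using fa_carrier_add[OF hideal_carrier[OF H yb] b] by simp
    then have "fa_mult (x - a) y + fa_mult a (y - b) \<in> hideal H"
      using xa yb a by (intro hideal.add hideal.lmult hideal.rmult)
    then show ?thesis
      by (simp add: hcos_eq_iff fa_mult_diff_left fa_mult_diff_right)
  qed
  moreover have "a \<in> hcos H a" "b \<in> hcos H b" by (simp_all add: hcos_def hideal.zero)
  ultimately show ?thesis unfolding eq by blast
qed

section \<open>The vertex sum as unit of the quotient\<close>

context
  fixes H :: hgraph
  assumes H: "finite_hypergraph H"
begin

lemma vertex_relation:
  assumes "u < nv H" "v < nv H"
  shows "monom [V u, V v] 1 - (if u = v then monom [V u] 1 else 0) \<in> hideal H"
  using assms by (intro hideal.rel) (auto simp: hrels_def)

text \<open>A generator absorbed by the vertex \<open>u\<close> on one side is killed by every other vertex there.\<close>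

lemma vsum_mult_absorbed_left:
  assumes g: "valid_gen H g" and u: "u < nv H"
    and abs: "monom [V u, g] (1::'k::field) - monom [g] (1::'k) \<in> hideal H"
  shows "fa_mult (vsum H) (monom [g] (1::'k)) - monom [g] (1::'k) \<in> hideal H"
proof -
  \<comment> \<open>The word \<open>v u g\<close> is congruent to \<open>v g\<close> by absorption
    and to 0 by orthogonality of \<open>v\<close> and \<open>u\<close>.\<close>
  have other: "monom [V v, g] (1::'k) \<in> hideal H" if "v < nv H" "v \<noteq> u" for v
  proof -
    have "fa_mult (monom [V v] (1::'k)) (monom [V u, g] (1::'k) - monom [g] (1::'k)) \<in> hideal H"
      using that abs by (intro hideal.lmult fa_carrier_monom) auto
    then have 1: "monom [V v, V u, g] (1::'k) - monom [V v, g] (1::'k) \<in> hideal H"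
      by (simp add: fa_mult_diff_right fa_mult_monom)
    have "fa_mult (monom [V v, V u] (1::'k) - 0) (monom [g] (1::'k)) \<in> hideal H"
      using that vertex_relation[OF that(1) u] g by (intro hideal.rmult fa_carrier_monom) auto
    then have "monom [V v, V u, g] (1::'k) \<in> hideal H"
      by (simp add: fa_mult_monom)
    from hideal_diff[OF this 1] show ?thesis by simp
  qed
  have "fa_mult (vsum H) (monom [g] (1::'k)) = (\<Sum>v<nv H. monom [V v, g] (1::'k))"
    by (simp add: vsum_def fa_mult_sum_left fa_mult_monom)
  also have "\<dots> = monom [V u, g] (1::'k) + (\<Sum>v\<in>{..<nv H} - {u}. monom [V v, g] (1::'k))"
    using u by (intro sum.remove) auto
  finally have "fa_mult (vsum H) (monom [g] (1::'k)) - monom [g] (1::'k)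
    = (monom [V u, g] (1::'k) - monom [g] (1::'k)) + (\<Sum>v\<in>{..<nv H} - {u}. monom [V v, g] (1::'k))" by simp
  also have "\<dots> \<in> hideal H"
    using abs other by (intro hideal.add hideal_sum) auto
  finally show ?thesis .
qed

lemma vsum_mult_absorbed_right:
  assumes g: "valid_gen H g" and u: "u < nv H"
    and abs: "monom [g, V u] (1::'k::field) - monom [g] (1::'k) \<in> hideal H"
  shows "fa_mult (monom [g] (1::'k)) (vsum H) - monom [g] (1::'k) \<in> hideal H"
proof -
  have other: "monom [g, V v] (1::'k) \<in> hideal H" if "v < nv H" "v \<noteq> u" for v
  proof -
    have "fa_mult (monom [g, V u] (1::'k) - monom [g] (1::'k)) (monom [V v] (1::'k)) \<in> hideal H"
      using that abs by (intro hideal.rmult fa_carrier_monom) auto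
    then have 1: "monom [g, V u, V v] (1::'k) - monom [g, V v] (1::'k) \<in> hideal H"
      by (simp add: fa_mult_diff_left fa_mult_monom)
    have "fa_mult (monom [g] (1::'k)) (monom [V u, V v] (1::'k) - 0) \<in> hideal H"
      using that vertex_relation[OF u that(1)] g by (intro hideal.lmult fa_carrier_monom) auto
    then have "monom [g, V u, V v] (1::'k) \<in> hideal H"
      by (simp add: fa_mult_monom)
    from hideal_diff[OF this 1] show ?thesis by simp
  qed
  have "fa_mult (monom [g] (1::'k)) (vsum H) = (\<Sum>v<nv H. monom [g, V v] (1::'k))"
    by (simp add: vsum_def fa_mult_sum_right fa_mult_monom)
  also have "\<dots> = monom [g, V u] (1::'k) + (\<Sum>v\<in>{..<nv H} - {u}. monom [g, V v] (1::'k))"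
    using u by (intro sum.remove) auto
  finally have "fa_mult (monom [g] (1::'k)) (vsum H) - monom [g] (1::'k)
    = (monom [g, V u] (1::'k) - monom [g] (1::'k)) + (\<Sum>v\<in>{..<nv H} - {u}. monom [g, V v] (1::'k))" by simp
  also have "\<dots> \<in> hideal H"
    using abs other by (intro hideal.add hideal_sum) auto
  finally show ?thesis .
qed

text \<open>Each generator has an absorbing vertex on either side: a vertex absorbs itself,
  \<open>E k i j\<close> has its source on the left and its range on the right, and
  \<open>Es k i j\<close> has them reversed.\<close>

lemma vsum_mult_gen:
  assumes g: "valid_gen H g"
  shows "fa_mult (vsum H) (monom [g] (1::'k::field)) - monom [g] (1::'k) \<in> hideal H"
    and "fa_mult (monom [g] (1::'k)) (vsum H) - monom [g] (1::'k) \<in> hideal H"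
proof -
  have "\<exists>u<nv H. monom [V u, g] (1::'k) - monom [g] (1::'k) \<in> hideal H"
  proof (cases g)
    case (V v)
    then show ?thesis using g vertex_relation[of v v] by auto
  next
    case (E k i j)
    then show ?thesis using g H
      by (intro exI[of _ "src H k i"] conjI hideal.rel) (auto simp: finite_hypergraph_def hrels_def)
  next
    case (Es k i j)
    then show ?thesis using g H
      by (intro exI[of _ "rng H k j"] conjI hideal.rel) (auto simp: finite_hypergraph_def hrels_def)
  qed
  then show "fa_mult (vsum H) (monom [g] (1::'k)) - monom [g] (1::'k) \<in> hideal H"
    using vsum_mult_absorbed_left[OF g] by blast
  have "\<exists>u<nv H. monom [g, V u] (1::'k) - monom [g] (1::'k) \<in> hideal H"
  proof (cases g)
    case (V v)
    then show ?thesis using g vertex_relation[of v v] by auto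
  next
    case (E k i j)
    then show ?thesis using g H
      by (intro exI[of _ "rng H k j"] conjI hideal.rel) (auto simp: finite_hypergraph_def hrels_def)
  next
    case (Es k i j)
    then show ?thesis using g H
      by (intro exI[of _ "src H k i"] conjI hideal.rel) (auto simp: finite_hypergraph_def hrels_def)
  qed
  then show "fa_mult (monom [g] (1::'k)) (vsum H) - monom [g] (1::'k) \<in> hideal H"
    using vsum_mult_absorbed_right[OF g] by blast
qed

text \<open>Only the first letter matters: the congruence for \<open>g\<close> is multiplied on the
  right by the rest of the word. For a one-letter word there is no rest to carry the coefficient
  \<open>c\<close>, so scalar multiplication supplies it.\<close>

lemma vsum_mult_monom_left:
  fixes c :: "'k::field"
  assumes "w \<noteq> []" "\<And>x. x \<in> set w \<Longrightarrow> valid_gen H x"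
  shows "fa_mult (vsum H) (monom w c) - monom w c \<in> hideal H"
proof -
  obtain g u where w: "w = g # u" using assms(1) by (cases w) auto
  have *: "fa_mult (vsum H) (monom [g] (1::'k)) - monom [g] (1::'k) \<in> hideal H"
    using assms(2) w by (intro vsum_mult_gen) auto
  show ?thesis
  proof (cases "u = []")
    case True
    have "(\<lambda>x. c * (fa_mult (vsum H) (monom [g] (1::'k)) - monom [g] (1::'k)) x) = fa_mult (vsum H) (monom w c) - monom w c"
      using True w by (auto simp: fun_eq_iff fa_mult_def monom_def algebra_simps sum_distrib_left intro!: sum.cong)
    then show ?thesis using hideal.smult[OF *, of c] by simp
  next
    case False
    have "fa_mult (fa_mult (vsum H) (monom [g] (1::'k)) - monom [g] (1::'k)) (monom u c) \<in> hideal H"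
      using * False assms(2) w by (intro hideal.rmult fa_carrier_monom) auto
    then show ?thesis using False w
      by (simp add: fa_mult_diff_left fa_mult_assoc fa_mult_monom)
  qed
qed

lemma vsum_mult_left:
  fixes f :: "gen list \<Rightarrow> 'k::field"
  assumes "f \<in> fa_carrier H"
  shows "fa_mult (vsum H) f - f \<in> hideal H"
  using assms
proof (induction rule: fa_carrier_induct)
  case zero
  show ?case unfolding fa_mult_zero_right diff_0_right by (rule hideal.zero)
next
  case (add f g)
  then show ?case
    unfolding fa_mult_add_right add_diff_add by (rule hideal.add)
next
  case (monom w c)
  then show ?case by (rule vsum_mult_monom_left)
qed

lemma vsum_mult_monom_right:
  fixes c :: "'k::field"
  assumes "w \<noteq> []" "\<And>x. x \<in> set w \<Longrightarrow> valid_gen H x"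
  shows "fa_mult (monom w c) (vsum H) - monom w c \<in> hideal H"
proof -
  obtain g u where w: "w = u @ [g]" using assms(1) by (cases w rule: rev_cases) auto
  have *: "fa_mult (monom [g] (1::'k)) (vsum H) - monom [g] (1::'k) \<in> hideal H"
    using assms(2) w by (intro vsum_mult_gen) auto
  show ?thesis
  proof (cases "u = []")
    case True
    have "(\<lambda>x. c * (fa_mult (monom [g] (1::'k)) (vsum H) - monom [g] (1::'k)) x) = fa_mult (monom w c) (vsum H) - monom w c"
      using True w by (auto simp: fun_eq_iff fa_mult_def monom_def algebra_simps sum_distrib_left intro!: sum.cong)
    then show ?thesis using hideal.smult[OF *, of c] by simp
  next
    case False
    have "fa_mult (monom u c) (fa_mult (monom [g] (1::'k)) (vsum H) - monom [g] (1::'k)) \<in> hideal H"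
      using * False assms(2) w by (intro hideal.lmult fa_carrier_monom) auto
    then show ?thesis using False w
      by (simp add: fa_mult_diff_right fa_mult_assoc[symmetric] fa_mult_monom)
  qed
qed

lemma vsum_mult_right:
  fixes f :: "gen list \<Rightarrow> 'k::field"
  assumes "f \<in> fa_carrier H"
  shows "fa_mult f (vsum H) - f \<in> hideal H"
  using assms
proof (induction rule: fa_carrier_induct)
  case zero
  show ?case unfolding fa_mult_zero_left diff_0_right by (rule hideal.zero)
next
  case (add f g)
  then show ?case
    unfolding fa_mult_add_left add_diff_add by (rule hideal.add)
next
  case (monom w c)
  then show ?case by (rule vsum_mult_monom_right)
qed

text \<open>In \<open>FA H\<close> the element \<open>vsum H\<close> is in general not a unit; it
  becomes one only modulo the ideal. The ring axioms are therefore verified directly on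
  cosets.\<close>

lemma ring_LK: "ring (LK H :: (gen list \<Rightarrow> 'k::field) set ring)" (is "ring ?L")
proof (rule ringI)
  show "abelian_group ?L"
  proof (rule abelian_groupI)
    show "\<exists>y\<in>carrier ?L. y \<oplus>\<^bsub>?L\<^esub> x = \<zero>\<^bsub>?L\<^esub>" if x: "x \<in> carrier ?L" for x
    proof -
      obtain a where a: "a \<in> fa_carrier H" "x = hcos H a"
        using x by (auto simp: carrier_LK)
      then have "hcos H (- a) \<in> carrier ?L" "hcos H (- a) \<oplus>\<^bsub>?L\<^esub> x = \<zero>\<^bsub>?L\<^esub>"
        by (auto simp: carrier_LK add_LK zero_LK fa_carrier_uminus)
      then show ?thesis by blast
    qed
  qed (auto simp: carrier_LK add_LK zero_LK fa_carrier_add fa_carrier_zero ac_simps)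
  have "hcos H (fa_mult (vsum H) a) = hcos H a" "hcos H (fa_mult a (vsum H)) = hcos H a"
    if "a \<in> fa_carrier H" for a :: "gen list \<Rightarrow> 'k"
    using that by (auto simp only: hcos_eq_iff vsum_mult_left vsum_mult_right)
  then show "Group.monoid ?L"
    by (intro monoidI)
      (auto simp: carrier_LK mult_LK[OF H] one_LK fa_mult_carrier vsum_carrier fa_mult_assoc)
qed (auto simp: carrier_LK mult_LK[OF H] add_LK fa_mult_carrier fa_carrier_add
    fa_mult_add_left fa_mult_add_right)

lemma vtx_carrier: "v < nv H \<Longrightarrow> vtx H v \<in> carrier (LK H)"
  by (auto simp: vtx_eq_hcos carrier_LK intro!: imageI fa_carrier_monom)

lemma vtx_mult:
  assumes "u < nv H" "v < nv H"
  shows "vtx H u \<otimes>\<^bsub>LK H\<^esub> (vtx H v :: (gen list \<Rightarrow> 'k::field) set)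
    = (if u = v then vtx H u else \<zero>\<^bsub>LK H\<^esub>)"
proof -
  have "vtx H u \<otimes>\<^bsub>LK H\<^esub> vtx H v = hcos H (monom [V u, V v] (1::'k))"
    using assms
    unfolding vtx_eq_hcos
    by (subst mult_LK[OF H]) (auto intro!: fa_carrier_monom simp: fa_mult_monom)
  then show ?thesis
    using vertex_relation[OF assms] by (auto simp: vtx_eq_hcos zero_LK hcos_eq_iff)
qed

lemma finsum_vtx:
  "(\<Oplus>\<^bsub>LK H\<^esub>v\<in>{..<nv H}. vtx H v :: (gen list \<Rightarrow> 'k::field) set) = \<one>\<^bsub>LK H\<^esub>"
proof -
  interpret ring "LK H :: (gen list \<Rightarrow> 'k) set ring" by (rule ring_LK)
  have "(\<Oplus>\<^bsub>LK H\<^esub>v\<in>{..<n}. vtx H v) = hcos H (\<Sum>v<n. monom [V v] (1::'k))" if "n \<le> nv H" for n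
    using that
  proof (induction n)
    case 0
    show ?case unfolding lessThan_0 finsum_empty sum.empty by (rule zero_LK)
  next
    case (Suc n)
    have "(\<Oplus>\<^bsub>LK H\<^esub>v\<in>{..<Suc n}. vtx H v :: (gen list \<Rightarrow> 'k) set) = vtx H n \<oplus>\<^bsub>LK H\<^esub> (\<Oplus>\<^bsub>LK H\<^esub>v\<in>{..<n}. vtx H v)"
      unfolding lessThan_Suc using Suc.prems by (intro finsum_insert) (auto intro!: vtx_carrier)
    also have "(\<Oplus>\<^bsub>LK H\<^esub>v\<in>{..<n}. vtx H v) = hcos H (\<Sum>v<n. monom [V v] (1::'k))"
      using Suc by simp
    also have "vtx H n \<oplus>\<^bsub>LK H\<^esub> \<dots> = hcos H (\<Sum>v<Suc n. monom [V v] (1::'k))"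
      unfolding vtx_eq_hcos add_LK sum.lessThan_Suc by (simp only: add.commute)
    finally show ?case .
  qed
  then show ?thesis by (simp add: one_LK vsum_def)
qed

end

section \<open>Rational solvability and ranks\<close>

text \<open>If \<open>c\<close> lies in the span, the column spaces coincide. Otherwise a maximal
  independent set of columns of \<open>A\<close> stays independent after adding \<open>c\<close>, so
  the rank grows. Only the set of columns enters, not their order.\<close>

lemma (in vec_space) rank_less_iff_notin_span:
  assumes A: "A \<in> carrier_mat n nc" and A': "A' \<in> carrier_mat n nc'" and c: "c \<in> carrier_vec n"
    and cols: "set (cols A') = insert c (set (cols A))"
  shows "rank A < rank A' \<longleftrightarrow> c \<notin> span (set (cols A))"
proof
  let ?S = "set (cols A)"
  have S: "?S \<subseteq> carrier_vec n" using A cols_dim by blast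
  {
    assume "c \<in> span ?S"
    then have "span (insert c ?S) \<subseteq> span ?S"
      using S in_own_span[of ?S] by (intro span_is_subset span_is_submodule) auto
    then have "span (insert c ?S) = span ?S"
      using span_is_monotone[of ?S "insert c ?S"] by auto
    then have "rank A = rank A'"
      by (simp add: rank_def cols)
  }
  then show "rank A < rank A' \<Longrightarrow> c \<notin> span ?S" by auto
  assume nc: "c \<notin> span ?S"
  obtain U where U: "finite U" "maximal U (\<lambda>T. T \<subseteq> ?S \<and> lin_indpt T)"
    using maximal_exists_superset[of ?S "\<lambda>T. T \<subseteq> ?S \<and> lin_indpt T" "{}"]
    by (auto simp: finite_lin_indpt2)
  then have US: "U \<subseteq> ?S" and Ui: "lin_indpt U" by (auto simp: maximal_def)
  have cU: "c \<notin> span U" using nc span_is_monotone[OF US] by blast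
  have Uc: "U \<subseteq> carrier_vec n" using US S by blast
  then have "c \<notin> U" using cU in_own_span[of U] by auto
  then have "lin_indpt (U \<union> {c})"
    using lin_dep_iff_in_span[of U c] Uc Ui c cU by auto
  then have "card (U \<union> {c}) \<le> rank A'"
    using US cols by (intro rank_ge_card_indpt[OF A']) auto
  moreover have "rank A = card U" by (rule rank_card_indpt[OF A U(2)])
  ultimately show "rank A < rank A'"
    using \<open>c \<notin> U\<close> U(1) by simp
qed

text \<open>The column space is the image of the matrix, so the rank grows exactly when the linear
  system with right-hand side \<open>c\<close> has no rational solution.\<close>

lemma rank_BAt_less_iff:
  "vec_space.rank (nv H) (BAt H) < vec_space.rank (nv H) (BAt_aug H) \<longleftrightarrow>
   \<not> (\<exists>q :: nat \<Rightarrow> rat. \<forall>l<nv H.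
        (\<Sum>k<ne H. of_int (int (Bmat H k l) - int (Amat H k l)) * q k) = 1)"
proof -
  interpret vec_space "TYPE(rat)" "nv H" .
  let ?c = "vec (nv H) (\<lambda>_. 1 :: rat)"
  have A: "BAt H \<in> carrier_mat (nv H) (ne H)" by (simp add: BAt_def)
  have A': "BAt_aug H \<in> carrier_mat (nv H) (ne H + 1)" by (simp add: BAt_aug_def)
  have col: "col (BAt_aug H) k = (if k < ne H then col (BAt H) k else ?c)" if "k < ne H + 1" for k
    using that by (auto simp: BAt_def BAt_aug_def)
  have "set (cols (BAt_aug H)) = col (BAt_aug H) ` {..<ne H + 1}"
    using A' by (simp add: cols_def lessThan_atLeast0 del: upt_Suc)
  also have "\<dots> = insert ?c (col (BAt H) ` {..<ne H})"
    using col by (auto simp: lessThan_Suc)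
  also have "col (BAt H) ` {..<ne H} = set (cols (BAt H))"
    using A by (simp add: cols_def lessThan_atLeast0)
  finally have "rank (BAt H) < rank (BAt_aug H) \<longleftrightarrow> ?c \<notin> col_space (BAt H)"
    unfolding col_space_def by (intro rank_less_iff_notin_span[OF A A']) auto
  also have "?c \<in> col_space (BAt H) \<longleftrightarrow> (\<exists>x\<in>carrier_vec (ne H). BAt H *\<^sub>v x = ?c)"
    using A by (simp add: col_space_eq[OF A])
  also have "\<dots> \<longleftrightarrow> (\<exists>q :: nat \<Rightarrow> rat. \<forall>l<nv H.
        (\<Sum>k<ne H. of_int (int (Bmat H k l) - int (Amat H k l)) * q k) = 1)"
  proof
    assume "\<exists>x\<in>carrier_vec (ne H). BAt H *\<^sub>v x = ?c"
    then obtain x where x: "x \<in> carrier_vec (ne H)" "BAt H *\<^sub>v x = ?c" by blast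
    have "(\<Sum>k<ne H. of_int (int (Bmat H k l) - int (Amat H k l)) * x $ k) = 1" if "l < nv H" for l
    proof -
      have "(BAt H *\<^sub>v x) $ l = ?c $ l" using x(2) by simp
      then show ?thesis
        using that x(1) by (simp add: BAt_def scalar_prod_def lessThan_atLeast0)
    qed
    then show "\<exists>q :: nat \<Rightarrow> rat. \<forall>l<nv H.
        (\<Sum>k<ne H. of_int (int (Bmat H k l) - int (Amat H k l)) * q k) = 1" by blast
  next
    assume "\<exists>q :: nat \<Rightarrow> rat. \<forall>l<nv H.
        (\<Sum>k<ne H. of_int (int (Bmat H k l) - int (Amat H k l)) * q k) = 1"
    then obtain q :: "nat \<Rightarrow> rat" where q: "\<And>l. l < nv H \<Longrightarrow>
        (\<Sum>k<ne H. of_int (int (Bmat H k l) - int (Amat H k l)) * q k) = 1" by blast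
    have "BAt H *\<^sub>v vec (ne H) q = ?c"
      using q by (intro eq_vecI) (auto simp: BAt_def scalar_prod_def lessThan_atLeast0)
    then show "\<exists>x\<in>carrier_vec (ne H). BAt H *\<^sub>v x = ?c"
      by (intro bexI[of _ "vec (ne H) q"]) auto
  qed
  finally show ?thesis .
qed

lemma common_denominator:
  fixes q :: "nat \<Rightarrow> rat"
  shows "\<exists>d::nat. 0 < d \<and> (\<exists>z::nat \<Rightarrow> int. \<forall>k<h. of_int (z k) = of_nat d * q k)"
proof (induction h)
  case 0
  show ?case by (intro exI[of _ 1]) auto
next
  case (Suc h)
  then obtain d z where d: "0 < d" "\<And>k. k < h \<Longrightarrow> of_int (z k) = of_nat d * q k" by blast
  obtain a b where ab: "quotient_of (q h) = (a, b)" by fastforce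
  have b: "b > 0" using quotient_of_denom_pos[OF ab] .
  have q: "q h = of_int a / of_int b" using quotient_of_div[OF ab] .
  \<comment> \<open>The new denominator is \<open>d * b\<close>: earlier numerators are scaled by
    \<open>b\<close>, the new one is \<open>d * a\<close>.\<close>
  have "of_int ((\<lambda>k. if k = h then int d * a else z k * b) k) = of_nat (d * nat b) * q k"
    if "k < Suc h" for k
    using that d(2)[of k] b q by (auto simp: less_Suc_eq)
  then show ?case
    using d(1) b by (intro exI[of _ "d * nat b"] conjI exI allI impI) auto
qed

section \<open>Moves\<close>

lemma Delta_Nil [simp]: "Delta H [] x = Some x"
  by (simp add: Delta_def)

lemma Delta_Cons [simp]: "Delta H (k # \<sigma>) x = Option.bind (Mop H k x) (Delta H \<sigma>)"
proof -
  have "fold (\<lambda>k ox. Option.bind ox (Mop H k)) \<sigma> None = None"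
    by (induction \<sigma>) auto
  then show ?thesis
    by (cases "Mop H k x") (auto simp: Delta_def)
qed

text \<open>Stated over the integers, where truncated subtraction disappears: the result depends
  only on how often each move is used, not on the order.\<close>

lemma Delta_value:
  "Delta H \<sigma> x = Some y \<Longrightarrow>
    int (y l) = int (x l) + (\<Sum>k\<leftarrow>\<sigma>. int (Bmat H k l) - int (Amat H k l))"
proof (induction \<sigma> arbitrary: x)
  case (Cons k \<sigma>)
  then obtain x' where x': "Mop H k x = Some x'" "Delta H \<sigma> x' = Some y"
    by (auto simp: bind_eq_Some_conv)
  then have "int (x' l) = int (x l) + (int (Bmat H k l) - int (Amat H k l))"
    by (auto simp: Mop_def of_nat_diff trans_le_add1 split: if_splits)
  then show ?case using Cons.IH[OF x'(2)] by simp
qed simp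

text \<open>It suffices to have the total demand of all moves in stock at the start, counting none
  of the gains \<open>Bmat\<close> along the way.\<close>

lemma Delta_defined:
  "(\<And>l. (\<Sum>k\<leftarrow>\<sigma>. Amat H k l) \<le> x l) \<Longrightarrow> \<exists>y. Delta H \<sigma> x = Some y"
proof (induction \<sigma> arbitrary: x)
  case (Cons k \<sigma>)
  have le: "Amat H k l + (\<Sum>k\<leftarrow>\<sigma>. Amat H k l) \<le> x l" for l
    using Cons.prems[of l] by simp
  have "\<forall>l. Amat H k l \<le> x l"
    using le add_leD1 by blast
  moreover have "\<exists>y. Delta H \<sigma> (\<lambda>l. x l - Amat H k l + Bmat H k l) = Some y"
  proof (rule Cons.IH)
    show "(\<Sum>k\<leftarrow>\<sigma>. Amat H k l) \<le> x l - Amat H k l + Bmat H k l" for l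
      using le[of l] by linarith
  qed
  ultimately show ?case by (simp add: Mop_def)
qed simp

lemma sum_list_eq_sum_count_list:
  fixes g :: "nat \<Rightarrow> int"
  assumes "set \<sigma> \<subseteq> {..<h}"
  shows "(\<Sum>k\<leftarrow>\<sigma>. g k) = (\<Sum>k<h. int (count_list \<sigma> k) * g k)"
  using assms
proof (induction \<sigma>)
  case (Cons a \<sigma>)
  have "(\<Sum>k<h. int (count_list (a # \<sigma>) k) * g k)
      = (\<Sum>k<h. (if k = a then g k else 0) + int (count_list \<sigma> k) * g k)"
    by (intro sum.cong) (auto simp: algebra_simps)
  also have "\<dots> = g a + (\<Sum>k\<leftarrow>\<sigma>. g k)"
    using Cons by (simp add: sum.distrib)
  finally show ?case by simp
qed simp

text \<open>Turns prescribed multiplicities into an actual sequence of moves, by repeating each move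
  in one block.\<close>

lemma ex_list_with_counts:
  fixes f :: "nat \<Rightarrow> nat"
  obtains \<sigma> where "set \<sigma> \<subseteq> {..<h}"
    and "\<And>g :: nat \<Rightarrow> int. (\<Sum>k\<leftarrow>\<sigma>. g k) = (\<Sum>k<h. int (f k) * g k)"
proof
  let ?\<sigma> = "concat (map (\<lambda>k. replicate (f k) k) [0..<h])"
  show "set ?\<sigma> \<subseteq> {..<h}" by auto
  show "(\<Sum>k\<leftarrow>?\<sigma>. g k) = (\<Sum>k<h. int (f k) * g k)" for g :: "nat \<Rightarrow> int"
    by (induction h) (simp_all add: sum_list_replicate)
qed

text \<open>\<open>Mop\<close> tests all indices, and elements of T vanish beyond the vertices;
  these coordinates neither block a move nor change under it.\<close>

lemma matrix_entries_outside:
  assumes "finite_hypergraph H" "k < ne H" "nv H \<le> l"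
  shows "Amat H k l = 0" "Bmat H k l = 0"
  using assms by (auto simp: Amat_def Bmat_def finite_hypergraph_def) (metis leD)+

section \<open>Isomorphic free modules, common descendants and rational solutions\<close>

lemma free_mod_iso_LK_iff_Tclass:
  assumes "finite_hypergraph H"
  shows "free_mod_iso (LK H :: (gen list \<Rightarrow> 'k::field) set ring) m p \<longleftrightarrow>
    (Tclass H (\<lambda>l. if l < nv H then m else 0) :: (nat \<Rightarrow> nat \<Rightarrow> (gen list \<Rightarrow> 'k) set) set)
      = Tclass H (\<lambda>l. if l < nv H then p else 0)"
  unfolding Tclass_def
  by (rule ring.free_mod_iso_iff_Vclass[OF ring_LK[OF assms]])
    (auto simp: vtx_carrier[OF assms] vtx_mult[OF assms] finsum_vtx[OF assms])

text \<open>Comparing the two runs in each vertex coordinate, the differences of the move counts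
  combine the vectors \<open>b_k - a_k\<close> to \<open>(m - p) c\<close>; division by
  \<open>m - p\<close> gives the coefficients.\<close>

lemma confluent_constants_imp_solution:
  assumes "set \<sigma> \<subseteq> {..<ne H}" "set \<sigma>' \<subseteq> {..<ne H}" "m \<noteq> p"
    and "Delta H \<sigma> (\<lambda>l. if l < nv H then m else 0) = Some y"
    and "Delta H \<sigma>' (\<lambda>l. if l < nv H then p else 0) = Some y"
  shows "\<exists>q :: nat \<Rightarrow> rat. \<forall>l<nv H.
    (\<Sum>k<ne H. of_int (int (Bmat H k l) - int (Amat H k l)) * q k) = 1"
proof -
  let ?g = "\<lambda>l k. int (Bmat H k l) - int (Amat H k l)"
  let ?z = "\<lambda>k. int (count_list \<sigma>' k) - int (count_list \<sigma> k)"
  let ?d = "int m - int p"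
  define q :: "nat \<Rightarrow> rat" where "q k = of_int (?z k) / of_int ?d" for k
  have d: "(of_int ?d :: rat) \<noteq> 0" using assms(3) by simp
  have "(\<Sum>k<ne H. of_int (?g l k) * q k) = 1" if l: "l < nv H" for l
  proof -
    have "int m + (\<Sum>k<ne H. int (count_list \<sigma> k) * ?g l k)
        = int p + (\<Sum>k<ne H. int (count_list \<sigma>' k) * ?g l k)"
      using Delta_value[OF assms(4), of l] Delta_value[OF assms(5), of l] l
      by (simp add: sum_list_eq_sum_count_list[OF assms(1)] sum_list_eq_sum_count_list[OF assms(2)])
    then have *: "(\<Sum>k<ne H. ?g l k * ?z k) = ?d"
      by (simp add: sum_subtractf algebra_simps)
    have "(\<Sum>k<ne H. of_int (?g l k) * q k) = of_int (\<Sum>k<ne H. ?g l k * ?z k) / of_int ?d"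
      unfolding q_def by (simp add: sum_divide_distrib)
    then show ?thesis unfolding * using d by simp
  qed
  then show ?thesis by blast
qed

lemma solution_imp_confluent_constants:
  assumes H: "finite_hypergraph H"
    and sol: "\<And>l. l < nv H \<Longrightarrow> (\<Sum>k<ne H. of_int (int (Bmat H k l) - int (Amat H k l)) * q k) = (1::rat)"
  shows "\<exists>m p \<sigma> \<sigma>' y. m \<noteq> p \<and> set \<sigma> \<subseteq> {..<ne H} \<and> set \<sigma>' \<subseteq> {..<ne H} \<and>
    Delta H \<sigma> (\<lambda>l. if l < nv H then m else 0) = Some y \<and>
    Delta H \<sigma>' (\<lambda>l. if l < nv H then p else 0) = Some y"
proof -
  let ?g = "\<lambda>l k. int (Bmat H k l) - int (Amat H k l)"
  obtain d z where d: "0 < d" and z: "\<And>k. k < ne H \<Longrightarrow> of_int (z k) = of_nat d * q k"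
    using common_denominator[of "ne H" q] by blast
  have zsol: "(\<Sum>k<ne H. z k * ?g l k) = int d" if "l < nv H" for l
  proof -
    have "of_int (\<Sum>k<ne H. z k * ?g l k) = (\<Sum>k<ne H. of_nat d * (of_int (?g l k) * q k))"
      unfolding of_int_sum of_int_mult using z by (intro sum.cong) auto
    also have "\<dots> = of_int (int d)"
      unfolding sum_distrib_left[symmetric] sol[OF that] by simp
    finally show ?thesis by (simp only: of_int_eq_iff)
  qed
  \<comment> \<open>Truncation by \<open>nat\<close> splits \<open>z\<close> into its positive part,
    used by \<open>\<sigma>\<close>, and its negative part, used by
    \<open>\<sigma>'\<close>.\<close>
  obtain \<sigma> where \<sigma>: "set \<sigma> \<subseteq> {..<ne H}"
    "\<And>g :: nat \<Rightarrow> int. (\<Sum>k\<leftarrow>\<sigma>. g k) = (\<Sum>k<ne H. int (nat (z k)) * g k)"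
    using ex_list_with_counts[of "ne H" "\<lambda>k. nat (z k)"] by blast
  obtain \<sigma>' where \<sigma>': "set \<sigma>' \<subseteq> {..<ne H}"
    "\<And>g :: nat \<Rightarrow> int. (\<Sum>k\<leftarrow>\<sigma>'. g k) = (\<Sum>k<ne H. int (nat (- z k)) * g k)"
    using ex_list_with_counts[of "ne H" "\<lambda>k. nat (- z k)"] by blast
  \<comment> \<open>The sum over all vertices of both total demands is a crude bound that covers
    every coordinate of either run.\<close>
  define M where "M = (\<Sum>l<nv H. (\<Sum>k\<leftarrow>\<sigma>. Amat H k l) + (\<Sum>k\<leftarrow>\<sigma>'. Amat H k l))"
  have M: "(\<Sum>k\<leftarrow>\<sigma>. Amat H k l) + (\<Sum>k\<leftarrow>\<sigma>'. Amat H k l) \<le> M" if "l < nv H" for l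
    unfolding M_def using that by (intro member_le_sum) auto
  have out: "(\<Sum>k\<leftarrow>\<tau>. Amat H k l) = 0" "(\<Sum>k\<leftarrow>\<tau>. ?g l k) = 0"
    if "set \<tau> \<subseteq> {..<ne H}" "nv H \<le> l" for \<tau> l
    using that matrix_entries_outside[OF H _ that(2)] by (induction \<tau>) auto
  obtain x where x: "Delta H \<sigma> (\<lambda>l. if l < nv H then M else 0) = Some x"
  proof -
    have "(\<Sum>k\<leftarrow>\<sigma>. Amat H k l) \<le> (if l < nv H then M else 0)" for l
      using M[of l] out(1)[OF \<sigma>(1), of l] by auto
    from Delta_defined[of H \<sigma>, OF this] show ?thesis using that by blast
  qed
  \<comment> \<open>The extra \<open>d\<close> balances the runs, since the net effect of
    \<open>\<sigma>\<close> minus that of \<open>\<sigma>'\<close> is \<open>d\<close> in every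
    vertex coordinate.\<close>
  obtain y where y: "Delta H \<sigma>' (\<lambda>l. if l < nv H then M + d else 0) = Some y"
  proof -
    have "(\<Sum>k\<leftarrow>\<sigma>'. Amat H k l) \<le> (if l < nv H then M + d else 0)" for l
      using M[of l] out(1)[OF \<sigma>'(1), of l] by auto
    from Delta_defined[of H \<sigma>', OF this] show ?thesis using that by blast
  qed
  have "x l = y l" for l
  proof (cases "l < nv H")
    case True
    have "(\<Sum>k<ne H. int (nat (z k)) * ?g l k) - (\<Sum>k<ne H. int (nat (- z k)) * ?g l k)
      = (\<Sum>k<ne H. z k * ?g l k)"
      unfolding sum_subtractf[symmetric] by (intro sum.cong) (auto simp: algebra_simps)
    also have "\<dots> = int d" using zsol True by blast
    finally have "int (x l) = int (y l)"
      using Delta_value[OF x, of l] Delta_value[OF y, of l] True by (simp add: \<sigma>(2) \<sigma>'(2))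
    then show ?thesis by simp
  next
    case False
    then show ?thesis
      using Delta_value[OF x, of l] Delta_value[OF y, of l] out(2)[OF \<sigma>(1)] out(2)[OF \<sigma>'(1)]
      by simp
  qed
  then have "x = y" by blast
  then show ?thesis
    using d x y \<sigma>(1) \<sigma>'(1)
    by (intro exI[of _ M] exI[of _ "M + d"] exI[of _ \<sigma>] exI[of _ \<sigma>'] exI[of _ y]) auto
qed

theorem mainTheorem18:
  fixes H :: hgraph
  assumes "finite_hypergraph H"
    and "confluence TYPE('k::field) H"
  shows "IBN (LK H :: (gen list \<Rightarrow> 'k) set ring)
         \<longleftrightarrow> vec_space.rank (nv H) (BAt H) < vec_space.rank (nv H) (BAt_aug H)"
proof -
  let ?L = "LK H :: (gen list \<Rightarrow> 'k) set ring"
  let ?x = "\<lambda>m l. if l < nv H then m else (0::nat)"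
  have inT: "inT (nv H) (?x m)" for m by (simp add: inT_def)
  \<comment> \<open>Here \<open>?x m\<close> is the element \<open>m c\<close> of T, and confluence
    replaces equality of classes by a common descendant.\<close>
  have iso: "free_mod_iso ?L m p \<longleftrightarrow> (\<exists>\<sigma> \<sigma>'. set \<sigma> \<subseteq> {..<ne H} \<and> set \<sigma>' \<subseteq> {..<ne H}
      \<and> Delta H \<sigma> (?x m) \<noteq> None \<and> Delta H \<sigma> (?x m) = Delta H \<sigma>' (?x p))" for m p
    unfolding free_mod_iso_LK_iff_Tclass[OF assms(1)]
    using assms(2) inT unfolding confluence_def by blast
  \<comment> \<open>Both sides of the theorem are negated: failure of Invariant Basis Number is
    matched with solvability of the linear system.\<close>
  have "\<not> IBN ?L \<longleftrightarrow> (\<exists>m p \<sigma> \<sigma>' y. m \<noteq> p \<and> set \<sigma> \<subseteq> {..<ne H} \<and> set \<sigma>' \<subseteq> {..<ne H} \<and>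
    Delta H \<sigma> (?x m) = Some y \<and> Delta H \<sigma>' (?x p) = Some y)"
    unfolding IBN_def iso by (metis not_None_eq)
  also have "\<dots> \<longleftrightarrow> (\<exists>q :: nat \<Rightarrow> rat. \<forall>l<nv H.
      (\<Sum>k<ne H. of_int (int (Bmat H k l) - int (Amat H k l)) * q k) = 1)"
  proof (intro iffI; elim exE conjE)
    fix m p \<sigma> \<sigma>' y
    assume "m \<noteq> p" "set \<sigma> \<subseteq> {..<ne H}" "set \<sigma>' \<subseteq> {..<ne H}"
      "Delta H \<sigma> (?x m) = Some y" "Delta H \<sigma>' (?x p) = Some y"
    then show "\<exists>q :: nat \<Rightarrow> rat. \<forall>l<nv H.
        (\<Sum>k<ne H. of_int (int (Bmat H k l) - int (Amat H k l)) * q k) = 1"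
      by (intro confluent_constants_imp_solution)
  next
    fix q :: "nat \<Rightarrow> rat"
    assume "\<forall>l<nv H. (\<Sum>k<ne H. of_int (int (Bmat H k l) - int (Amat H k l)) * q k) = 1"
    then show "\<exists>m p \<sigma> \<sigma>' y. m \<noteq> p \<and> set \<sigma> \<subseteq> {..<ne H} \<and> set \<sigma>' \<subseteq> {..<ne H} \<and>
        Delta H \<sigma> (?x m) = Some y \<and> Delta H \<sigma>' (?x p) = Some y"
      by (intro solution_imp_confluent_constants[OF assms(1), of q]) blast
  qed
  finally show ?thesis
    unfolding rank_BAt_less_iff by blast
qed

end
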